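(* Let $\mathcal H_1$ and $\mathcal H_2$ be two infinite dimensional Hilbert spaces. Let $\mathcal K_1:=S_2(\mathcal H_1)$ and $\mathcal K_2:=S_2(\mathcal H_2)$, the Banach algebras of Hilbert-Schmidt operators (with composition as multiplication). Then the Banach algebra $\mathcal K_1\otimes^\gamma\mathcal K_2$ (the projective tensor product) is not Arens regular.
   Context: Hilbert spaces are complex. For a Hilbert space $\mathcal H$, $S_2(\mathcal H)$ is the space of Hilbert-Schmidt operators on $\mathcal H$, with inner product $\langle A,B\rangle=\operatorname{Tr}(B^*A)$ and the corresponding norm; it is a Banach algebra under composition of operators. Projective tensor product: for Banach algebras $A,B$, the algebraic tensor product $A\otimes B$ has multiplication determined by $(x_1\otimes y_1)(x_2\otimes y_2)=x_1x_2\otimes y_1y_2$ and norm $\|u\|_\gamma=\inf\{\sum_{i=1}^n\|x_i\|\|y_i\| : u=\sum_{i=1}^n x_i\otimes y_i\}$; its completion is the Banach algebra $A\otimes^\gamma B$. Arens regularity: let $A$ be a normed algebra. For $a\in A$, $\omega\in A^*$, $f\in A^{**}$ define $\omega_a,{}_a\omega\in A^*$ by $\omega_a(b)=\omega(ab)$, ${}_a\omega(b)=\omega(ba)$, and $\omega_f,{}_f\omega\in A^*$ by $\omega_f(a)=f({}_a\omega)$, ${}_f\omega(a)=f(\omega_a)$. For $f,g\in A^{**}$ set $(f\Box g)(\omega)=f({}_g\omega)$ and $(f\diamond g)(\omega)=g(\omega_f)$ for $\omega\in A^*$. $A$ is Arens regular if $f\Box g=f\diamond g$ for all $f,g\in A^{**}$.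 *)

theory Defs
  imports "HOL-Analysis.Analysis"
begin

section \<open>Complex vector spaces, normed algebras and Hilbert spaces\<close>

text \<open>The distribution only has real normed and real inner product spaces; the classes below add
  a compatible complex scalar multiplication.\<close>

class complex_vector = real_vector +
  fixes scaleC :: "complex \<Rightarrow> 'a \<Rightarrow> 'a"  (infixr "*\<^sub>C" 75)
  assumes scaleC_add_right: "a *\<^sub>C (x + y) = a *\<^sub>C x + a *\<^sub>C y"
    and scaleC_add_left: "(a + b) *\<^sub>C x = a *\<^sub>C x + b *\<^sub>C x"
    and scaleC_scaleC: "a *\<^sub>C (b *\<^sub>C x) = (a * b) *\<^sub>C x"
    and scaleR_scaleC: "r *\<^sub>R x = complex_of_real r *\<^sub>C x"
begin

lemma scaleC_one [simp]: "1 *\<^sub>C x = x"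
  using scaleR_scaleC [of 1 x] by (simp add: scaleR_one)

end

global_interpretation complex_vector: vector_space "scaleC :: complex \<Rightarrow> 'a \<Rightarrow> 'a::complex_vector"
  by standard (simp_all add: scaleC_add_right scaleC_add_left scaleC_scaleC)

class complex_normed_vector = complex_vector + real_normed_vector +
  assumes norm_scaleC: "norm (a *\<^sub>C x) = cmod a * norm x"

class complex_normed_algebra = complex_normed_vector + real_normed_algebra +
  assumes mult_scaleC_left: "(a *\<^sub>C x) * y = a *\<^sub>C (x * y)"
    and mult_scaleC_right: "x * (a *\<^sub>C y) = a *\<^sub>C (x * y)"

class complex_banach_algebra = complex_normed_algebra + complete_space

text \<open>The inner product \<open>cinner\<close> is linear in its first argument.  The superclass
  \<^class>\<open>real_inner\<close> provides positive definiteness and the norm.\<close>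

class complex_inner = complex_vector + real_inner +
  fixes cinner :: "'a \<Rightarrow> 'a \<Rightarrow> complex"
  assumes cinner_commute: "cinner x y = cnj (cinner y x)"
    and cinner_add_left: "cinner (x + y) z = cinner x z + cinner y z"
    and cinner_scaleC_left: "cinner (a *\<^sub>C x) y = a * cinner x y"
    and inner_eq_Re_cinner: "inner x y = Re (cinner x y)"
begin

lemma cinner_add_right: "cinner x (y + z) = cinner x y + cinner x z"
  by (metis cinner_commute cinner_add_left complex_cnj_add)

lemma cinner_scaleC_right: "cinner x (a *\<^sub>C y) = cnj a * cinner x y"
  by (metis cinner_commute cinner_scaleC_left complex_cnj_mult)

lemma cinner_self: "cinner x x = complex_of_real ((norm x)\<^sup>2)"
proof -
  have "Im (cinner x x) = 0"
    using cinner_commute [of x x] by (metis complex_cnj add.inverse_neutral complex.sel(2) equal_neg_zero cnj.sel(2))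
  moreover have "Re (cinner x x) = (norm x)\<^sup>2"
    by (simp add: inner_eq_Re_cinner [symmetric] power2_norm_eq_inner)
  ultimately show ?thesis
    by (simp add: complex_eq_iff)
qed

end

class complex_hilbert_space = complex_inner + complete_space

instance complex_hilbert_space \<subseteq> banach ..

lemma mult_cnj_cmod: "z * cnj z = complex_of_real ((cmod z)\<^sup>2)"
  by (rule complex_norm_square [symmetric])

lemma cnj_mult_cmod: "cnj z * z = complex_of_real ((cmod z)\<^sup>2)"
  by (simp add: mult_cnj_cmod mult.commute)

lemma cinner_zero_left [simp]: "cinner 0 (y::'a::complex_inner) = 0"
  using cinner_add_left [of 0 0 y] by simp

lemma cinner_zero_right [simp]: "cinner (x::'a::complex_inner) 0 = 0"
  using cinner_add_right [of x 0 0] by simp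

lemma cinner_minus_left: "cinner (- x) (y::'a::complex_inner) = - cinner x y"
  using cinner_add_left [of x "- x" y] by (simp add: add_eq_0_iff)

lemma cinner_minus_right: "cinner x (- y::'a::complex_inner) = - cinner x y"
  using cinner_add_right [of x y "- y"] by (simp add: add_eq_0_iff)

lemma cinner_diff_left: "cinner (x - y) (z::'a::complex_inner) = cinner x z - cinner y z"
  using cinner_add_left [of x "- y" z] by (simp add: cinner_minus_left)

lemma cinner_diff_right: "cinner x (y - z::'a::complex_inner) = cinner x y - cinner x z"
  using cinner_add_right [of x y "- z"] by (simp add: cinner_minus_right)

lemma cinner_sum_left: "cinner (\<Sum>i\<in>A. f i) (y::'a::complex_inner) = (\<Sum>i\<in>A. cinner (f i) y)"
  by (induct A rule: infinite_finite_induct) (simp_all add: cinner_add_left)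

lemma cinner_sum_right: "cinner (y::'a::complex_inner) (\<Sum>i\<in>A. f i) = (\<Sum>i\<in>A. cinner y (f i))"
  by (induct A rule: infinite_finite_induct) (simp_all add: cinner_add_right)

lemma cmod_cinner_le: "cmod (cinner x (y::'a::complex_inner)) \<le> norm x * norm y"
proof (cases "cinner x y = 0")
  case False
  define c where "c = cnj (cinner x y) / cmod (cinner x y)"
  have c1: "cmod c = 1"
    using False by (simp add: c_def norm_divide)
  have "norm (c *\<^sub>C x) ^ 2 = norm x ^ 2"
  proof -
    have "cinner (c *\<^sub>C x) (c *\<^sub>C x) = (c * cnj c) * cinner x x"
      by (simp add: cinner_scaleC_left cinner_scaleC_right)
    also have "c * cnj c = 1"
      using c1 by (simp add: mult_cnj_cmod)
    finally show ?thesis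
      by (metis cinner_self mult_1 of_real_eq_iff)
  qed
  hence n: "norm (c *\<^sub>C x) = norm x"
    by simp
  have "cinner (c *\<^sub>C x) y = complex_of_real (cmod (cinner x y))"
    using False
    by (simp add: c_def cinner_scaleC_left complex_norm_square [symmetric] mult.commute field_simps power2_eq_square)
  hence "cmod (cinner x y) = inner (c *\<^sub>C x) y"
    by (simp add: inner_eq_Re_cinner)
  also have "\<dots> \<le> norm x * norm y"
    using norm_cauchy_schwarz [of "c *\<^sub>C x" y] n by simp
  finally show ?thesis .
qed simp

instance complex_inner \<subseteq> complex_normed_vector
proof
  fix a :: complex and x :: 'a
  have "cinner (a *\<^sub>C x) (a *\<^sub>C x) = (a * cnj a) * cinner x x"
    by (simp add: cinner_scaleC_left cinner_scaleC_right)
  hence "(norm (a *\<^sub>C x))\<^sup>2 = (cmod a * norm x)\<^sup>2"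
    unfolding cinner_self mult_cnj_cmod
    by (metis of_real_eq_iff of_real_mult power_mult_distrib of_real_power)
  thus "norm (a *\<^sub>C x) = cmod a * norm x"
    by simp
qed

instantiation complex :: complex_banach_algebra
begin

definition scaleC_complex :: "complex \<Rightarrow> complex \<Rightarrow> complex"
  where [simp]: "scaleC_complex c z = c * z"

instance
  by standard (simp_all add: algebra_simps norm_mult scaleR_conv_of_real)

end

instantiation complex :: complex_hilbert_space
begin

definition cinner_complex :: "complex \<Rightarrow> complex \<Rightarrow> complex"
  where "cinner_complex x y = x * cnj y"

instance
  by standard (simp_all add: cinner_complex_def algebra_simps inner_complex_def)

end

definition infinite_dimensional :: "'a::complex_vector itself \<Rightarrow> bool"
  where "infinite_dimensional (H :: 'a itself) \<longleftrightarrow>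
    \<not> (\<exists>B :: 'a set. finite B \<and> complex_vector.span B = UNIV)"

definition bounded_clinear :: "('a::complex_normed_vector \<Rightarrow> 'b::complex_normed_vector) \<Rightarrow> bool"
  where "bounded_clinear f \<longleftrightarrow> bounded_linear f \<and> (\<forall>c x. f (c *\<^sub>C x) = c *\<^sub>C f x)"

lemma bounded_clinear_cinner_left: "bounded_clinear (\<lambda>x. cinner x (y::'a::complex_inner))"
  unfolding bounded_clinear_def
proof (intro conjI allI)
  show "bounded_linear (\<lambda>x. cinner x y)"
    by (rule bounded_linear_intro [of _ "norm y"])
      (simp_all add: cinner_add_left scaleR_scaleC cinner_scaleC_left cmod_cinner_le scaleR_conv_of_real)
qed (simp add: cinner_scaleC_left)

lemma bounded_linear_cinner_left: "bounded_linear (\<lambda>x. cinner x (y::'a::complex_inner))"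
  using bounded_clinear_cinner_left bounded_clinear_def by blast

lemma bounded_linear_cinner_right: "bounded_linear (\<lambda>y. cinner (x::'a::complex_inner) y)"
  by (rule bounded_linear_intro [of _ "norm x"])
    (simp_all add: cinner_add_right scaleR_scaleC cinner_scaleC_right scaleR_conv_of_real
      cmod_cinner_le mult.commute [of "norm _" "norm x"])


section \<open>Orthonormal bases\<close>

definition orthonormal :: "'a::complex_inner set \<Rightarrow> bool"
  where "orthonormal E \<longleftrightarrow> (\<forall>e\<in>E. norm e = 1) \<and> (\<forall>e\<in>E. \<forall>f\<in>E. e \<noteq> f \<longrightarrow> cinner e f = 0)"

text \<open>An orthonormal basis (of a Hilbert space) is a maximal orthonormal set.\<close>

definition is_onb :: "'a::complex_inner set \<Rightarrow> bool"
  where "is_onb E \<longleftrightarrow> orthonormal E \<and> (\<forall>F. orthonormal F \<longrightarrow> E \<subseteq> F \<longrightarrow> F = E)"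

lemma orthonormal_cinner:
  assumes "orthonormal E" "e \<in> E" "f \<in> E"
  shows "cinner e f = (if e = f then 1 else 0)"
  using assms by (auto simp: orthonormal_def cinner_self)

lemma is_onb_zeroI:
  assumes "is_onb E" and orth: "\<And>e. e \<in> E \<Longrightarrow> cinner x e = 0"
  shows "x = 0"
proof (rule ccontr)
  assume x: "x \<noteq> 0"
  define u where "u = complex_of_real (1 / norm x) *\<^sub>C x"
  have nu: "norm u = 1"
    using x by (simp add: u_def norm_scaleC norm_divide)
  have ue: "cinner u e = 0" if "e \<in> E" for e
    using orth [OF that] by (simp add: u_def cinner_scaleC_left)
  have eu: "cinner e u = 0" if "e \<in> E" for e
    using ue [OF that] by (subst cinner_commute) simp
  have "orthonormal (insert u E)"
    using \<open>is_onb E\<close> nu ue eu unfolding is_onb_def orthonormal_def by auto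
  hence "insert u E = E"
    using \<open>is_onb E\<close> unfolding is_onb_def by blast
  hence "u \<in> E" by blast
  hence "cinner u u = 0" by (rule ue)
  thus False using nu by (simp add: cinner_self)
qed

lemma ex_onb: "\<exists>E :: 'a::complex_inner set. is_onb E"
proof -
  have "\<exists>M\<in>{E :: 'a set. orthonormal E}. \<forall>X\<in>{E. orthonormal E}. M \<subseteq> X \<longrightarrow> X = M"
  proof (rule subset_Zorn_nonempty)
    have "orthonormal ({} :: 'a set)" by (simp add: orthonormal_def)
    thus "{E :: 'a set. orthonormal E} \<noteq> {}" by blast
  next
    fix \<C> :: "'a set set"
    assume ne: "\<C> \<noteq> {}" and ch: "subset.chain {E. orthonormal E} \<C>"
    have on: "orthonormal E" if "E \<in> \<C>" for E
      using ch that by (auto simp: subset_chain_def)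
    have "orthonormal (\<Union>\<C>)"
      unfolding orthonormal_def
    proof (intro conjI ballI impI)
      fix e assume "e \<in> \<Union>\<C>"
      thus "norm e = 1" using on by (auto simp: orthonormal_def)
    next
      fix e f assume "e \<in> \<Union>\<C>" "f \<in> \<Union>\<C>" "e \<noteq> f"
      then obtain E F where "E \<in> \<C>" "F \<in> \<C>" "e \<in> E" "f \<in> F" by blast
      moreover from this ch have "E \<subseteq> F \<or> F \<subseteq> E"
        by (auto simp: subset_chain_def)
      ultimately show "cinner e f = 0"
        using on \<open>e \<noteq> f\<close> unfolding orthonormal_def by (meson subsetD)
    qed
    thus "\<Union>\<C> \<in> {E. orthonormal E}" by simp
  qed
  thus ?thesis unfolding is_onb_def by blast
qed

lemma norm_sum_onb:
  fixes E :: "'a::complex_inner set"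
  assumes "orthonormal E" "finite F" "F \<subseteq> E"
  shows "(norm (\<Sum>e\<in>F. c e *\<^sub>C e))\<^sup>2 = (\<Sum>e\<in>F. (cmod (c e))\<^sup>2)"
proof -
  have "cinner (\<Sum>e\<in>F. c e *\<^sub>C e) (\<Sum>e\<in>F. c e *\<^sub>C e)
      = (\<Sum>e\<in>F. \<Sum>f\<in>F. c e * (cnj (c f) * cinner e f))"
    unfolding cinner_sum_left
    by (simp add: cinner_sum_right cinner_scaleC_left cinner_scaleC_right
        sum_distrib_left mult.left_commute)
  also have "\<dots> = (\<Sum>e\<in>F. \<Sum>f\<in>F. if e = f then c e * cnj (c f) else 0)"
    using assms by (intro sum.cong refl) (auto simp: orthonormal_cinner subset_iff)
  also have "\<dots> = (\<Sum>e\<in>F. c e * cnj (c e))"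
    using \<open>finite F\<close> by (simp add: sum.delta)
  also have "\<dots> = complex_of_real (\<Sum>e\<in>F. (cmod (c e))\<^sup>2)"
    by (simp add: mult_cnj_cmod)
  finally show ?thesis
    by (simp only: cinner_self of_real_eq_iff)
qed

lemma bessel:
  fixes x :: "'a::complex_inner"
  assumes "orthonormal E" "finite F" "F \<subseteq> E"
  shows "(\<Sum>e\<in>F. (cmod (cinner x e))\<^sup>2) = (norm x)\<^sup>2 - (norm (x - (\<Sum>e\<in>F. cinner x e *\<^sub>C e)))\<^sup>2"
proof -
  define s where "s = (\<Sum>e\<in>F. cinner x e *\<^sub>C e)"
  define r where "r = (\<Sum>e\<in>F. (cmod (cinner x e))\<^sup>2)"
  have xs: "cinner x s = complex_of_real r"
    by (simp add: s_def r_def cinner_sum_right cinner_scaleC_right mult_cnj_cmod mult.commute)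
  have sx: "cinner s x = complex_of_real r"
    using cinner_commute [of s x] xs by simp
  have ss: "cinner s s = complex_of_real r"
    unfolding cinner_self s_def r_def norm_sum_onb [OF assms] ..
  have "complex_of_real ((norm (x - s))\<^sup>2) = complex_of_real ((norm x)\<^sup>2 - r)"
    unfolding cinner_self [symmetric] cinner_diff_left cinner_diff_right xs sx ss of_real_diff
    by simp
  hence "(norm (x - s))\<^sup>2 = (norm x)\<^sup>2 - r"
    by (simp only: of_real_eq_iff)
  thus ?thesis
    unfolding s_def r_def by simp
qed

lemma riesz_fischer:
  fixes E :: "'a::complex_hilbert_space set"
  assumes on: "orthonormal E" and sq: "(\<lambda>e. (cmod (c e))\<^sup>2) summable_on E"
  shows "(\<lambda>e. c e *\<^sub>C e) summable_on E"
proof -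
  let ?f = "\<lambda>e. c e *\<^sub>C e"
  let ?g = "\<lambda>e. (cmod (c e))\<^sup>2"
  have "\<exists>P. eventually P (finite_subsets_at_top E) \<and>
      (\<forall>F F'. P F \<and> P F' \<longrightarrow> dist (sum ?f F) (sum ?f F') < d)" if "d > 0" for d
  proof -
    have dpos: "(d/4)\<^sup>2 > 0" using that by simp
    obtain F0 where F0: "finite F0" "F0 \<subseteq> E" "dist (sum ?g F0) (infsum ?g E) \<le> (d/4)\<^sup>2"
      using infsum_finite_approximation [OF sq dpos] by blast
    have near: "dist (sum ?f F) (sum ?f F0) \<le> d/4" if F: "finite F" "F0 \<subseteq> F" "F \<subseteq> E" for F
    proof -
      have "(dist (sum ?f F) (sum ?f F0))\<^sup>2 = (norm (sum ?f (F - F0)))\<^sup>2"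
        using F by (simp add: dist_norm sum_diff)
      also have "\<dots> = sum ?g (F - F0)"
        using F by (intro norm_sum_onb [OF on]) auto
      also have "\<dots> = sum ?g F - sum ?g F0"
        using F by (simp add: sum_diff)
      also have "\<dots> \<le> infsum ?g E - sum ?g F0"
        using F by (intro diff_right_mono finite_sum_le_infsum [OF sq]) auto
      also have "\<dots> \<le> (d/4)\<^sup>2"
        using F0(3) unfolding dist_real_def by linarith
      finally show ?thesis
        by (rule power2_le_imp_le) (use \<open>d > 0\<close> in simp)
    qed
    show ?thesis
    proof (intro exI conjI allI impI)
      show "eventually (\<lambda>F. finite F \<and> F0 \<subseteq> F \<and> F \<subseteq> E) (finite_subsets_at_top E)"
        using F0 unfolding eventually_finite_subsets_at_top by blast
      fix F F' assume a: "(finite F \<and> F0 \<subseteq> F \<and> F \<subseteq> E) \<and> (finite F' \<and> F0 \<subseteq> F' \<and> F' \<subseteq> E)"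
      have "dist (sum ?f F) (sum ?f F') \<le> dist (sum ?f F) (sum ?f F0) + dist (sum ?f F') (sum ?f F0)"
        by (rule dist_triangle2)
      also have "\<dots> \<le> d/4 + d/4"
        using a by (intro add_mono near) auto
      also have "\<dots> < d" using \<open>d > 0\<close> by simp
      finally show "dist (sum ?f F) (sum ?f F') < d" .
    qed
  qed
  hence "cauchy_filter (filtermap (sum ?f) (finite_subsets_at_top E))"
    by (simp add: cauchy_filter_metric_filtermap)
  moreover have "complete (UNIV::'a set)"
    by (meson Cauchy_convergent UNIV_I complete_def convergent_def)
  ultimately obtain L where "(sum ?f \<longlongrightarrow> L) (finite_subsets_at_top E)"
    using complete_uniform [where S=UNIV] by (force simp add: filterlim_def)
  thus ?thesis
    unfolding summable_on_def has_sum_def by blast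
qed

lemma cinner_has_sum_onb:
  assumes "orthonormal E" "((\<lambda>e. c e *\<^sub>C e) has_sum x) E" "f \<in> E"
  shows "cinner x f = c f"
proof -
  have "((\<lambda>e. cinner (c e *\<^sub>C e) f) has_sum cinner x f) E"
    by (rule has_sum_bounded_linear [OF bounded_linear_cinner_left assms(2)])
  moreover have "((\<lambda>e. cinner (c e *\<^sub>C e) f) has_sum c f) E"
    by (rule has_sum_finite_neutralI [of "{f}"])
      (use assms in \<open>auto simp: cinner_scaleC_left orthonormal_cinner\<close>)
  ultimately show ?thesis
    by (rule has_sum_unique)
qed

lemma bessel_summable:
  assumes "orthonormal E"
  shows "(\<lambda>e. (cmod (cinner x e))\<^sup>2) summable_on E"
  by (rule nonneg_bdd_above_summable_on)
    (auto intro!: bdd_aboveI2 [of _ _ "(norm x)\<^sup>2"] simp: bessel [OF assms])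

lemma onb_expansion:
  fixes x :: "'a::complex_hilbert_space"
  assumes E: "is_onb E"
  shows "((\<lambda>e. cinner x e *\<^sub>C e) has_sum x) E"
proof -
  have on: "orthonormal E" using E by (simp add: is_onb_def)
  obtain s where s: "((\<lambda>e. cinner x e *\<^sub>C e) has_sum s) E"
    using riesz_fischer [OF on bessel_summable [OF on]] unfolding summable_on_def by blast
  have "x - s = 0"
    using cinner_has_sum_onb [OF on s] by (intro is_onb_zeroI [OF E]) (simp add: cinner_diff_left)
  thus ?thesis using s by simp
qed

lemma parseval:
  fixes x :: "'a::complex_hilbert_space"
  assumes E: "is_onb E"
  shows "((\<lambda>e. (cmod (cinner x e))\<^sup>2) has_sum (norm x)\<^sup>2) E"
proof -
  have "((\<lambda>e. cinner (cinner x e *\<^sub>C e) x) has_sum cinner x x) E"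
    by (rule has_sum_bounded_linear [OF bounded_linear_cinner_left onb_expansion [OF E]])
  moreover have "cinner (cinner x e *\<^sub>C e) x = complex_of_real ((cmod (cinner x e))\<^sup>2)" for e
    by (simp add: cinner_scaleC_left cinner_commute [of e x] mult_cnj_cmod)
  ultimately have "((\<lambda>e. complex_of_real ((cmod (cinner x e))\<^sup>2)) has_sum complex_of_real ((norm x)\<^sup>2)) E"
    by (simp add: cinner_self)
  thus ?thesis
    by (simp only: has_sum_of_real_iff)
qed


section \<open>Hilbert-Schmidt operators\<close>

definition cadjoint :: "('a::complex_inner \<Rightarrow> 'a) \<Rightarrow> 'a \<Rightarrow> 'a"
  where "cadjoint T = (SOME S. \<forall>x y. cinner (S x) y = cinner x (T y))"

lemma bounded_clinearD:
  assumes "bounded_clinear T"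
  shows "bounded_linear T" "T (c *\<^sub>C x) = c *\<^sub>C T x"
  using assms by (auto simp: bounded_clinear_def)

lemma power2_le_multD:
  fixes a b :: real
  assumes "a\<^sup>2 \<le> b * a" "0 \<le> a" "0 \<le> b"
  shows "a \<le> b"
proof (cases "a = 0")
  case False
  with assms have "a * a \<le> b * a" "0 < a" by (simp_all add: power2_eq_square)
  thus ?thesis by simp
qed (use assms in simp)

lemma ex_adjoint:
  fixes T :: "'a::complex_hilbert_space \<Rightarrow> 'a"
  assumes T: "bounded_clinear T"
  shows "\<exists>S. \<forall>x y. cinner (S x) y = cinner x (T y)"
proof -
  obtain E :: "'a set" where E: "is_onb E" using ex_onb by blast
  have on: "orthonormal E" using E by (simp add: is_onb_def)
  interpret T: bounded_linear T using T by (rule bounded_clinearD)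
  obtain K where K: "K \<ge> 0" "\<And>x. norm (T x) \<le> norm x * K"
    using T.nonneg_bounded by blast
  have "\<exists>z. \<forall>y. cinner z y = cinner x (T y)" for x
  proof -
    let ?c = "\<lambda>e. cinner x (T e)"
    have bd: "(\<Sum>e\<in>F. (cmod (?c e))\<^sup>2) \<le> (norm x * K)\<^sup>2" if F: "finite F" "F \<subseteq> E" for F
    proof -
      define w where "w = (\<Sum>e\<in>F. ?c e *\<^sub>C e)"
      have nw: "(norm w)\<^sup>2 = (\<Sum>e\<in>F. (cmod (?c e))\<^sup>2)"
        unfolding w_def using on F by (intro norm_sum_onb)
      have "cinner x (T w) = complex_of_real (\<Sum>e\<in>F. (cmod (?c e))\<^sup>2)"
        by (simp add: w_def T.sum bounded_clinearD [OF T] cinner_sum_right cinner_scaleC_right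
            cnj_mult_cmod)
      hence "(norm w)\<^sup>2 = cmod (cinner x (T w))"
        unfolding nw by (simp add: norm_of_real sum_nonneg del: of_real_sum)
      also have "\<dots> \<le> norm x * (norm w * K)"
        by (rule order_trans [OF cmod_cinner_le mult_left_mono [OF K(2) norm_ge_zero]])
      also have "\<dots> = (norm x * K) * norm w"
        by simp
      finally have "norm w \<le> norm x * K"
        by (rule power2_le_multD) (simp_all add: K(1))
      thus ?thesis
        unfolding nw [symmetric] by (rule power_mono) simp
    qed
    have summ: "(\<lambda>e. (cmod (?c e))\<^sup>2) summable_on E"
    proof (rule nonneg_bdd_above_summable_on)
      show "bdd_above (sum (\<lambda>e. (cmod (?c e))\<^sup>2) ` {F. F \<subseteq> E \<and> finite F})"
        by (rule bdd_aboveI2 [of _ _ "(norm x * K)\<^sup>2"]) (simp add: bd)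
    qed simp
    obtain z where z: "((\<lambda>e. ?c e *\<^sub>C e) has_sum z) E"
      using riesz_fischer [OF on summ] unfolding summable_on_def by blast
    have "cinner z y = cinner x (T y)" for y
    proof -
      have zy: "((\<lambda>e. cinner (?c e *\<^sub>C e) y) has_sum cinner z y) E"
        by (rule has_sum_bounded_linear [OF bounded_linear_cinner_left z])
      have xTy: "((\<lambda>e. cinner x (T (cinner y e *\<^sub>C e))) has_sum cinner x (T y)) E"
        by (rule has_sum_bounded_linear [OF bounded_linear_cinner_right
            has_sum_bounded_linear [OF bounded_clinearD(1) [OF T] onb_expansion [OF E]]])
      have eq: "cinner x (T (cinner y e *\<^sub>C e)) = cinner (?c e *\<^sub>C e) y" for e
        unfolding bounded_clinearD(2) [OF T] cinner_scaleC_left cinner_scaleC_right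
        by (subst cinner_commute [of e y]) (rule mult.commute)
      show ?thesis
        by (rule has_sum_unique [OF zy xTy [unfolded eq]])
    qed
    thus ?thesis by (intro exI allI)
  qed
  thus ?thesis by (rule choice [OF allI])
qed

lemma cinner_cadjoint:
  assumes "bounded_clinear (T :: 'a::complex_hilbert_space \<Rightarrow> 'a)"
  shows "cinner (cadjoint T x) y = cinner x (T y)"
  using someI_ex [OF ex_adjoint [OF assms]] unfolding cadjoint_def by simp

text \<open>For trace class operators the sum does not depend on the chosen orthonormal basis; for the
  products of two Hilbert-Schmidt operators used here, see \<open>has_sum_cinner_hs\<close> below.\<close>

definition ctrace :: "('a::complex_inner \<Rightarrow> 'a) \<Rightarrow> complex"
  where "ctrace T = (\<Sum>\<^sub>\<infinity>e\<in>(SOME E. is_onb E). cinner (T e) e)"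

definition hilbert_schmidt :: "('a::complex_inner \<Rightarrow> 'a) \<Rightarrow> bool"
  where "hilbert_schmidt T \<longleftrightarrow>
    bounded_clinear T \<and> (\<exists>E. is_onb E \<and> (\<lambda>e. (norm (T e))\<^sup>2) summable_on E)"

lemma has_sum_adjoint:
  fixes T S :: "'a::complex_hilbert_space \<Rightarrow> 'a"
  assumes adj: "\<And>x y. cinner (S x) y = cinner x (T y)"
    and E: "is_onb E" and F: "is_onb F"
    and sum: "((\<lambda>e. (norm (T e))\<^sup>2) has_sum s) E"
  shows "((\<lambda>f. (norm (S f))\<^sup>2) has_sum s) F"
proof -
  let ?g = "\<lambda>(e, f). (cmod (cinner (T e) f))\<^sup>2"
  have inner: "((\<lambda>f. ?g (e, f)) has_sum (norm (T e))\<^sup>2) F" for e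
    using parseval [OF F, of "T e"] by simp
  have "?g summable_on E \<times> F"
    using sum by (intro summable_on_SigmaI [OF inner]) (auto simp: summable_on_def)
  hence "(?g has_sum s) (E \<times> F)"
    by (intro has_sum_SigmaI [OF inner sum])
  hence "((\<lambda>(f, e). ?g (e, f)) has_sum s) (F \<times> E)"
    by (subst (asm) has_sum_swap)
  moreover have "((\<lambda>e. (\<lambda>(f, e). ?g (e, f)) (f, e)) has_sum (norm (S f))\<^sup>2) E" for f
  proof -
    have "cmod (cinner (T e) f) = cmod (cinner (S f) e)" for e
      using adj [of f e] cinner_commute [of "T e" f] by simp
    thus ?thesis
      using parseval [OF E, of "S f"] by simp
  qed
  ultimately show ?thesis
    by (rule has_sum_SigmaD)
qed

lemma hilbert_schmidt_onb_indep:
  fixes T :: "'a::complex_hilbert_space \<Rightarrow> 'a"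
  assumes T: "bounded_clinear T" and E: "is_onb E" and F: "is_onb F"
    and sum: "((\<lambda>e. (norm (T e))\<^sup>2) has_sum s) E"
  shows "((\<lambda>e. (norm (T e))\<^sup>2) has_sum s) F"
proof (rule has_sum_adjoint [OF _ E F])
  show "cinner (T x) y = cinner x (cadjoint T y)" for x y
    using cinner_cadjoint [OF T, of y x] cinner_commute [of "T x" y] cinner_commute [of x "cadjoint T y"]
    by simp
  show "((\<lambda>e. (norm (cadjoint T e))\<^sup>2) has_sum s) E"
    by (rule has_sum_adjoint [OF _ E E sum]) (rule cinner_cadjoint [OF T])
qed

lemma hilbert_schmidt_summable:
  fixes T :: "'a::complex_hilbert_space \<Rightarrow> 'a"
  assumes "hilbert_schmidt T" "is_onb E"
  shows "(\<lambda>e. (norm (T e))\<^sup>2) summable_on E"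
proof -
  obtain F where F: "bounded_clinear T" "is_onb F" "(\<lambda>e. (norm (T e))\<^sup>2) summable_on F"
    using assms(1) unfolding hilbert_schmidt_def by blast
  show ?thesis
    unfolding summable_on_def
    by (rule exI, rule hilbert_schmidt_onb_indep [OF F(1,2) assms(2)], rule has_sum_infsum [OF F(3)])
qed

lemma bounded_clinear_zero: "bounded_clinear (\<lambda>x. 0)"
  by (simp add: bounded_clinear_def)

lemma bounded_clinear_add:
  "bounded_clinear S \<Longrightarrow> bounded_clinear T \<Longrightarrow> bounded_clinear (\<lambda>x. S x + T x)"
  by (auto simp: bounded_clinear_def scaleC_add_right intro: bounded_linear_add)

lemma bounded_linear_scaleC: "bounded_linear (\<lambda>x::'a::complex_normed_vector. c *\<^sub>C x)"
  by (rule bounded_linear_intro [of _ "cmod c"])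
    (simp_all add: scaleC_add_right scaleR_scaleC scaleC_scaleC norm_scaleC mult.commute)

lemma bounded_clinear_scaleC:
  "bounded_clinear T \<Longrightarrow> bounded_clinear (\<lambda>x. c *\<^sub>C T x)"
  by (auto simp: bounded_clinear_def scaleC_scaleC mult.commute
      intro: bounded_linear_compose [OF bounded_linear_scaleC])

lemma bounded_clinear_compose:
  "bounded_clinear S \<Longrightarrow> bounded_clinear T \<Longrightarrow> bounded_clinear (\<lambda>x. S (T x))"
  by (auto simp: bounded_clinear_def intro: bounded_linear_compose)

lemma hilbert_schmidt_zero: "hilbert_schmidt (\<lambda>x. 0)"
  using ex_onb by (auto simp: hilbert_schmidt_def bounded_clinear_zero)

lemma hilbert_schmidt_scaleC:
  assumes "hilbert_schmidt T"
  shows "hilbert_schmidt (\<lambda>x. c *\<^sub>C T x)"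
  using assms unfolding hilbert_schmidt_def
  by (auto simp: bounded_clinear_scaleC norm_scaleC power_mult_distrib intro: summable_on_cmult_right)

lemma hilbert_schmidt_add:
  fixes S T :: "'a::complex_hilbert_space \<Rightarrow> 'a"
  assumes "hilbert_schmidt S" "hilbert_schmidt T"
  shows "hilbert_schmidt (\<lambda>x. S x + T x)"
proof -
  obtain E :: "'a set" where E: "is_onb E" using ex_onb by blast
  have "(\<lambda>e. 2 * (norm (S e))\<^sup>2 + 2 * (norm (T e))\<^sup>2) summable_on E"
    using assms E by (intro summable_on_add summable_on_cmult_right hilbert_schmidt_summable)
  moreover have "(norm (S e + T e))\<^sup>2 \<le> 2 * (norm (S e))\<^sup>2 + 2 * (norm (T e))\<^sup>2" for e
  proof -
    have "(norm (S e + T e))\<^sup>2 \<le> (norm (S e) + norm (T e))\<^sup>2"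
      by (simp add: norm_triangle_ineq power_mono)
    also have "\<dots> \<le> 2 * (norm (S e))\<^sup>2 + 2 * (norm (T e))\<^sup>2"
      using sum_squares_bound [of "norm (S e)" "norm (T e)"] by (simp add: power2_sum)
    finally show ?thesis .
  qed
  ultimately have "(\<lambda>e. (norm (S e + T e))\<^sup>2) summable_on E"
    by (rule summable_on_comparison_test) auto
  thus ?thesis
    using assms E bounded_clinear_add unfolding hilbert_schmidt_def by blast
qed

lemma hilbert_schmidt_diff:
  fixes S T :: "'a::complex_hilbert_space \<Rightarrow> 'a"
  assumes "hilbert_schmidt S" "hilbert_schmidt T"
  shows "hilbert_schmidt (\<lambda>x. S x - T x)"
  using hilbert_schmidt_add [OF assms(1) hilbert_schmidt_scaleC [OF assms(2), of "-1"]] by simp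

lemma hilbert_schmidt_compose:
  fixes S T :: "'a::complex_hilbert_space \<Rightarrow> 'a"
  assumes "hilbert_schmidt S" "hilbert_schmidt T"
  shows "hilbert_schmidt (\<lambda>x. S (T x))"
proof -
  obtain E :: "'a set" where E: "is_onb E" using ex_onb by blast
  have bS: "bounded_linear S" using assms by (simp add: hilbert_schmidt_def bounded_clinear_def)
  obtain K where K: "K \<ge> 0" "\<And>x. norm (S x) \<le> norm x * K"
    using bounded_linear.nonneg_bounded [OF bS] by blast
  have "(\<lambda>e. K\<^sup>2 * (norm (T e))\<^sup>2) summable_on E"
    using assms E by (intro summable_on_cmult_right hilbert_schmidt_summable)
  moreover have "(norm (S (T e)))\<^sup>2 \<le> K\<^sup>2 * (norm (T e))\<^sup>2" for e
    using power_mono [OF K(2) [of "T e"], of 2] by (simp add: power_mult_distrib mult.commute)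
  ultimately have "(\<lambda>e. (norm (S (T e)))\<^sup>2) summable_on E"
    by (rule summable_on_comparison_test) auto
  thus ?thesis
    using assms E bounded_clinear_compose unfolding hilbert_schmidt_def by blast
qed

typedef (overloaded) 'a hs_op = "{T :: 'a::complex_hilbert_space \<Rightarrow> 'a. hilbert_schmidt T}"
  morphisms hs_apply Abs_hs_op
  using hilbert_schmidt_zero by blast

setup_lifting type_definition_hs_op

instantiation hs_op :: (complex_hilbert_space) complex_vector
begin

lift_definition zero_hs_op :: "'a hs_op" is "\<lambda>x. 0"
  by (rule hilbert_schmidt_zero)

lift_definition plus_hs_op :: "'a hs_op \<Rightarrow> 'a hs_op \<Rightarrow> 'a hs_op" is "\<lambda>S T x. S x + T x"
  by (rule hilbert_schmidt_add)

lift_definition scaleC_hs_op :: "complex \<Rightarrow> 'a hs_op \<Rightarrow> 'a hs_op" is "\<lambda>c T x. c *\<^sub>C T x"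
  by (rule hilbert_schmidt_scaleC)

definition scaleR_hs_op :: "real \<Rightarrow> 'a hs_op \<Rightarrow> 'a hs_op"
  where "scaleR_hs_op r T = complex_of_real r *\<^sub>C T"

lift_definition uminus_hs_op :: "'a hs_op \<Rightarrow> 'a hs_op" is "\<lambda>T x. - T x"
  using hilbert_schmidt_scaleC [where c = "-1"] by simp

lift_definition minus_hs_op :: "'a hs_op \<Rightarrow> 'a hs_op \<Rightarrow> 'a hs_op" is "\<lambda>S T x. S x - T x"
  by (rule hilbert_schmidt_diff)

instance
proof
  fix S T U :: "'a hs_op" and a b :: complex and r q :: real
  show "S + T + U = S + (T + U)" by transfer (simp add: add.assoc)
  show "S + T = T + S" by transfer (simp add: add.commute)
  show "0 + S = S" by transfer simp
  show "- S + S = 0" by transfer simp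
  show "S - T = S + - T" by transfer simp
  show "a *\<^sub>C (S + T) = a *\<^sub>C S + a *\<^sub>C T" by transfer (simp add: scaleC_add_right)
  show "(a + b) *\<^sub>C S = a *\<^sub>C S + b *\<^sub>C S" by transfer (simp add: scaleC_add_left)
  show "a *\<^sub>C (b *\<^sub>C S) = (a * b) *\<^sub>C S" by transfer (simp add: scaleC_scaleC)
  show "r *\<^sub>R S = complex_of_real r *\<^sub>C S" by (rule scaleR_hs_op_def)
  show "r *\<^sub>R (S + T) = r *\<^sub>R S + r *\<^sub>R T"
    unfolding scaleR_hs_op_def by transfer (simp add: scaleC_add_right)
  show "(r + q) *\<^sub>R S = r *\<^sub>R S + q *\<^sub>R S"
    unfolding scaleR_hs_op_def by transfer (simp add: scaleC_add_left)
  show "r *\<^sub>R (q *\<^sub>R S) = (r * q) *\<^sub>R S"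
    unfolding scaleR_hs_op_def by transfer (simp add: scaleC_scaleC)
  show "1 *\<^sub>R S = S"
    unfolding scaleR_hs_op_def by transfer simp
qed

end

lemmas hs_apply_simps = zero_hs_op.rep_eq plus_hs_op.rep_eq scaleC_hs_op.rep_eq
  uminus_hs_op.rep_eq minus_hs_op.rep_eq

lemma hs_apply_hs: "hilbert_schmidt (hs_apply T)"
  using hs_apply by blast

lemma hs_apply_bounded_clinear: "bounded_clinear (hs_apply T)"
  using hs_apply_hs hilbert_schmidt_def by blast

text \<open>The Hilbert-Schmidt inner product $\langle A, B\rangle = \mathrm{Tr}(B^* A)$.\<close>

definition hs_inner :: "'a::complex_hilbert_space hs_op \<Rightarrow> 'a hs_op \<Rightarrow> complex"
  where "hs_inner A B = ctrace (cadjoint (hs_apply B) \<circ> hs_apply A)"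

lemma polarization:
  "4 * cinner x (y::'a::complex_inner) =
    complex_of_real ((norm (x + y))\<^sup>2) - complex_of_real ((norm (x - y))\<^sup>2)
    + \<i> * complex_of_real ((norm (x + \<i> *\<^sub>C y))\<^sup>2) - \<i> * complex_of_real ((norm (x - \<i> *\<^sub>C y))\<^sup>2)"
  unfolding cinner_self [symmetric]
  by (simp add: cinner_add_left cinner_add_right cinner_diff_left cinner_diff_right
      cinner_scaleC_left cinner_scaleC_right algebra_simps)

lemma has_sum_cinner_hs:
  assumes E: "is_onb E"
  shows "((\<lambda>e. cinner (hs_apply A e) (hs_apply B e)) has_sum hs_inner A B) E"
proof -
  let ?E = "SOME E :: 'a set. is_onb E"
  have E': "is_onb ?E" using ex_onb by (rule someI_ex)
  let ?n = "\<lambda>C E. \<Sum>\<^sub>\<infinity>e\<in>E. (norm (hs_apply C e))\<^sup>2"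
  have n: "((\<lambda>e. (norm (hs_apply C e))\<^sup>2) has_sum ?n C ?E) F" if "is_onb F" for C F
    by (intro hilbert_schmidt_onb_indep [OF hs_apply_bounded_clinear E' that] has_sum_infsum
        hilbert_schmidt_summable [OF hs_apply_hs E'])
  let ?N = "\<lambda>C. complex_of_real (?n C ?E)"
  define s where "s = (?N (A + B) - ?N (A - B) + \<i> * ?N (A + \<i> *\<^sub>C B) - \<i> * ?N (A - \<i> *\<^sub>C B)) / 4"
  have s: "((\<lambda>e. cinner (hs_apply A e) (hs_apply B e)) has_sum s) F" if F: "is_onb F" for F
  proof -
    let ?h = "\<lambda>C e. complex_of_real ((norm (hs_apply C e))\<^sup>2)"
    have N: "(?h C has_sum ?N C) F" for C
      using n [OF F] by (rule has_sum_of_real)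
    have "((\<lambda>e. (?h (A + B) e - ?h (A - B) e + \<i> * ?h (A + \<i> *\<^sub>C B) e - \<i> * ?h (A - \<i> *\<^sub>C B) e) / 4)
        has_sum s) F"
      unfolding s_def diff_conv_add_uminus divide_inverse
      by (intro has_sum_cmult_left has_sum_add has_sum_uminusI has_sum_cmult_right
          N [unfolded diff_conv_add_uminus])
    moreover have "(?h (A + B) e - ?h (A - B) e + \<i> * ?h (A + \<i> *\<^sub>C B) e - \<i> * ?h (A - \<i> *\<^sub>C B) e) / 4
        = cinner (hs_apply A e) (hs_apply B e)" for e
      unfolding hs_apply_simps polarization [symmetric] by simp
    ultimately show ?thesis
      by simp
  qed
  have "cinner (cadjoint (hs_apply B) (hs_apply A e)) e = cinner (hs_apply A e) (hs_apply B e)" for e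
    by (rule cinner_cadjoint [OF hs_apply_bounded_clinear])
  hence "hs_inner A B = s"
    using infsumI [OF s [OF E']] by (simp add: hs_inner_def ctrace_def)
  with s [OF E] show ?thesis by simp
qed

lemma hs_apply_eqI:
  assumes E: "is_onb E" and "\<And>e. e \<in> E \<Longrightarrow> hs_apply T e = 0"
  shows "T = 0"
proof -
  have bl: "bounded_linear (hs_apply T)"
    using hs_apply_bounded_clinear bounded_clinearD(1) by blast
  have "hs_apply T x = 0" for x
  proof -
    have "((\<lambda>e. hs_apply T (cinner x e *\<^sub>C e)) has_sum hs_apply T x) E"
      by (rule has_sum_bounded_linear [OF bl onb_expansion [OF E]])
    moreover have "hs_apply T (cinner x e *\<^sub>C e) = 0" if "e \<in> E" for e
      using that assms by (simp add: bounded_clinearD [OF hs_apply_bounded_clinear])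
    ultimately show ?thesis
      by (metis (no_types, lifting) has_sum_0 has_sum_unique)
  qed
  thus ?thesis
    by (metis (no_types) ext hs_apply_inject hs_apply_simps(1))
qed

instantiation hs_op :: (complex_hilbert_space) complex_inner
begin

definition cinner_hs_op :: "'a hs_op \<Rightarrow> 'a hs_op \<Rightarrow> complex"
  where "cinner_hs_op = hs_inner"

definition inner_hs_op :: "'a hs_op \<Rightarrow> 'a hs_op \<Rightarrow> real"
  where "inner_hs_op A B = Re (cinner A B)"

definition norm_hs_op :: "'a hs_op \<Rightarrow> real"
  where "norm_hs_op A = sqrt (Re (cinner A A))"

definition dist_hs_op :: "'a hs_op \<Rightarrow> 'a hs_op \<Rightarrow> real"
  where "dist_hs_op A B = norm (A - B)"

definition sgn_hs_op :: "'a hs_op \<Rightarrow> 'a hs_op"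
  where "sgn_hs_op A = A /\<^sub>R norm A"

definition uniformity_hs_op :: "('a hs_op \<times> 'a hs_op) filter"
  where "uniformity_hs_op = (INF e\<in>{0 <..}. principal {(x, y). dist x y < e})"

definition open_hs_op :: "'a hs_op set \<Rightarrow> bool"
  where "open_hs_op U = (\<forall>x\<in>U. \<forall>\<^sub>F (x', y) in uniformity. x' = x \<longrightarrow> y \<in> U)"

instance
proof
  fix A B C :: "'a hs_op" and r :: real and c :: complex
  obtain E :: "'a set" where E: "is_onb E" using ex_onb by blast
  note sums = has_sum_cinner_hs [OF E, folded cinner_hs_op_def]
  show dist: "dist A B = norm (A - B)"
    by (rule dist_hs_op_def)
  show "sgn A = A /\<^sub>R norm A"
    by (rule sgn_hs_op_def)
  show "(uniformity :: ('a hs_op \<times> 'a hs_op) filter) = (INF e\<in>{0 <..}. principal {(x, y). dist x y < e})"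
    by (rule uniformity_hs_op_def)
  show "open U = (\<forall>x\<in>U. \<forall>\<^sub>F (x', y) in uniformity. x' = x \<longrightarrow> y \<in> U)" for U :: "'a hs_op set"
    by (rule open_hs_op_def)
  show comm: "cinner A B = cnj (cinner B A)" for A B :: "'a hs_op"
  proof (rule has_sum_unique [OF sums])
    show "((\<lambda>e. cinner (hs_apply A e) (hs_apply B e)) has_sum cnj (cinner B A)) E"
      using sums [of B A] by (subst cinner_commute, subst has_sum_cnj_iff)
  qed
  show addl: "cinner (A + B) C = cinner A C + cinner B C"
    using has_sum_unique [OF sums [of "A + B" C]] has_sum_add [OF sums [of A C] sums [of B C]]
    by (simp add: hs_apply_simps cinner_add_left)
  show scal: "cinner (c *\<^sub>C A) B = c * cinner A B" for c
    using has_sum_unique [OF sums [of "c *\<^sub>C A" B]] has_sum_cmult_right [OF sums [of A B], of c]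
    by (simp add: hs_apply_simps cinner_scaleC_left)
  show "inner A B = Re (cinner A B)"
    by (rule inner_hs_op_def)
  show "inner A B = inner B A"
    unfolding inner_hs_op_def using comm [of A B] by simp
  show "inner (A + B) C = inner A C + inner B C"
    by (simp add: inner_hs_op_def addl)
  show "inner (r *\<^sub>R A) B = r * inner A B"
    by (simp add: inner_hs_op_def scaleR_scaleC scal)
  have sq: "((\<lambda>e. (norm (hs_apply A e))\<^sup>2) has_sum inner A A) E"
    using has_sum_Re [OF sums [of A A]] by (simp add: inner_hs_op_def cinner_self)
  show nn: "0 \<le> inner A A"
    by (rule has_sum_nonneg [OF sq]) simp
  show "inner A A = 0 \<longleftrightarrow> A = 0"
  proof
    assume "inner A A = 0"
    hence "(norm (hs_apply A e))\<^sup>2 = 0" if "e \<in> E" for e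
      using sq that by (intro nonneg_has_sum_le_0D [OF sq]) auto
    thus "A = 0"
      by (intro hs_apply_eqI [OF E]) simp
  next
    assume "A = 0"
    thus "inner A A = 0"
      using has_sum_unique [OF sq] by (simp add: hs_apply_simps)
  qed
  show "norm A = sqrt (inner A A)"
    by (simp add: norm_hs_op_def inner_hs_op_def)
qed

end

lemma has_sum_norm_hs:
  assumes "is_onb E"
  shows "((\<lambda>e. (norm (hs_apply A e))\<^sup>2) has_sum (norm A)\<^sup>2) E"
  using has_sum_Re [OF has_sum_cinner_hs [OF assms, of A A]]
  by (simp add: cinner_self cinner_hs_op_def [symmetric])

lemma norm_hs_apply_le: "norm (hs_apply A x) \<le> norm A * norm x"
proof -
  obtain E :: "'a set" where E: "is_onb E" using ex_onb by blast
  have on: "orthonormal E" using E by (simp add: is_onb_def)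
  have bl: "bounded_linear (hs_apply A)"
    using hs_apply_bounded_clinear bounded_clinearD(1) by blast
  let ?f = "\<lambda>e. hs_apply A (cinner x e *\<^sub>C e)"
  have "(?f has_sum hs_apply A x) E"
    by (rule has_sum_bounded_linear [OF bl onb_expansion [OF E]])
  hence lim: "((\<lambda>F. norm (sum ?f F)) \<longlongrightarrow> norm (hs_apply A x)) (finite_subsets_at_top E)"
    unfolding has_sum_def by (rule tendsto_norm)
  have "norm (sum ?f F) \<le> norm A * norm x" if F: "finite F" "F \<subseteq> E" for F
  proof -
    have "norm (sum ?f F) \<le> (\<Sum>e\<in>F. \<bar>cmod (cinner x e)\<bar> * \<bar>norm (hs_apply A e)\<bar>)"
      by (rule sum_norm_le) (simp add: bounded_clinearD [OF hs_apply_bounded_clinear] norm_scaleC)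
    also have "\<dots> \<le> L2_set (\<lambda>e. cmod (cinner x e)) F * L2_set (\<lambda>e. norm (hs_apply A e)) F"
      by (rule L2_set_mult_ineq)
    also have "\<dots> \<le> norm x * norm A"
    proof (intro mult_mono)
      have "(\<Sum>e\<in>F. (cmod (cinner x e))\<^sup>2) \<le> (norm x)\<^sup>2"
        using bessel [OF on F] by simp
      thus "L2_set (\<lambda>e. cmod (cinner x e)) F \<le> norm x"
        unfolding L2_set_def by (simp add: real_le_lsqrt)
      have "(\<Sum>e\<in>F. (norm (hs_apply A e))\<^sup>2) \<le> (norm A)\<^sup>2"
        by (rule finite_sum_le_has_sum [OF has_sum_norm_hs [OF E] F]) simp
      thus "L2_set (\<lambda>e. norm (hs_apply A e)) F \<le> norm A"
        unfolding L2_set_def by (simp add: real_le_lsqrt)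
    qed (simp_all add: L2_set_nonneg)
    finally show ?thesis by (simp add: mult.commute)
  qed
  thus ?thesis
    by (rule tendsto_upperbound [OF lim eventually_finite_subsets_at_top_weakI]) simp_all
qed

instantiation hs_op :: (complex_hilbert_space) complex_normed_algebra
begin

lift_definition times_hs_op :: "'a hs_op \<Rightarrow> 'a hs_op \<Rightarrow> 'a hs_op" is "\<lambda>S T x. S (T x)"
  by (drule (1) hilbert_schmidt_compose)

instance
proof
  fix A B C :: "'a hs_op" and r :: real and c :: complex
  note lin = bounded_clinearD [OF hs_apply_bounded_clinear]
  note add = linear_add [OF bounded_linear.linear [OF lin(1)]]
  note eqI = hs_apply_inject [THEN iffD1, OF ext]
  show "(A * B) * C = A * (B * C)"
    by (rule eqI) (simp add: times_hs_op.rep_eq)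
  show "(A + B) * C = A * C + B * C"
    by (rule eqI) (simp add: times_hs_op.rep_eq hs_apply_simps)
  show "A * (B + C) = A * B + A * C"
    by (rule eqI) (simp add: times_hs_op.rep_eq hs_apply_simps add)
  show c1: "(c *\<^sub>C A) * B = c *\<^sub>C (A * B)" for c
    by (rule eqI) (simp add: times_hs_op.rep_eq hs_apply_simps)
  show c2: "A * (c *\<^sub>C B) = c *\<^sub>C (A * B)" for c
    by (rule eqI) (simp add: times_hs_op.rep_eq hs_apply_simps lin)
  show "(r *\<^sub>R A) * B = r *\<^sub>R (A * B)" "A * (r *\<^sub>R B) = r *\<^sub>R (A * B)"
    by (simp_all add: scaleR_scaleC c1 c2)
  obtain E :: "'a set" where E: "is_onb E" using ex_onb by blast
  have "(norm (A * B))\<^sup>2 \<le> (norm A)\<^sup>2 * (norm B)\<^sup>2"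
  proof (rule has_sum_mono [OF has_sum_norm_hs [OF E] has_sum_cmult_right [OF has_sum_norm_hs [OF E]]])
    fix e
    show "(norm (hs_apply (A * B) e))\<^sup>2 \<le> (norm A)\<^sup>2 * (norm (hs_apply B e))\<^sup>2"
      using power_mono [OF norm_hs_apply_le [of A "hs_apply B e"], of 2]
      by (simp add: times_hs_op.rep_eq power_mult_distrib)
  qed
  hence "(norm (A * B))\<^sup>2 \<le> (norm A * norm B)\<^sup>2"
    by (simp add: power_mult_distrib)
  thus "norm (A * B) \<le> norm A * norm B"
    by (rule power2_le_imp_le) simp
qed

end

instance hs_op :: (complex_hilbert_space) complete_space
proof
  fix X :: "nat \<Rightarrow> 'a hs_op" assume X: "Cauchy X"
  obtain E :: "'a set" where E: "is_onb E" using ex_onb by blast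
  have XC: "\<exists>N. \<forall>m\<ge>N. \<forall>n\<ge>N. norm (X m - X n) < d" if "d > 0" for d
    using X that unfolding Cauchy_def dist_norm by blast
  have apply_le: "norm (hs_apply (X m) x - hs_apply (X n) x) \<le> norm (X m - X n) * norm x" for m n x
    using norm_hs_apply_le [of "X m - X n" x] by (simp add: hs_apply_simps)
  have "Cauchy (\<lambda>n. hs_apply (X n) x)" for x
  proof (rule CauchyI)
    fix d :: real assume "d > 0"
    hence "d / (norm x + 1) > 0"
      by (simp add: add_nonneg_pos)
    then obtain N where N: "\<And>m n. m \<ge> N \<Longrightarrow> n \<ge> N \<Longrightarrow> norm (X m - X n) < d / (norm x + 1)"
      using XC by blast
    have "norm (hs_apply (X m) x - hs_apply (X n) x) < d" if "m \<ge> N" "n \<ge> N" for m n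
    proof -
      have "norm (hs_apply (X m) x - hs_apply (X n) x) \<le> norm (X m - X n) * (norm x + 1)"
        by (rule order_trans [OF apply_le]) (simp add: mult_left_mono)
      also have "\<dots> < d"
        using N [OF that] by (simp add: pos_less_divide_eq add_nonneg_pos)
      finally show ?thesis .
    qed
    thus "\<exists>M. \<forall>m\<ge>M. \<forall>n\<ge>M. norm (hs_apply (X m) x - hs_apply (X n) x) < d" by blast
  qed
  hence "\<forall>x. \<exists>y. (\<lambda>n. hs_apply (X n) x) \<longlonglongrightarrow> y"
    using Cauchy_convergent convergent_def by blast
  then obtain T where T: "\<And>x. (\<lambda>n. hs_apply (X n) x) \<longlonglongrightarrow> T x"
    by metis
  note lin = bounded_clinearD [OF hs_apply_bounded_clinear]
  note add = linear_add [OF bounded_linear.linear [OF lin(1)]]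
  obtain K where K: "\<And>n. norm (X n) \<le> K"
    using Cauchy_Bseq [OF X] unfolding Bseq_def by blast
  have Tadd: "T (x + y) = T x + T y" for x y
    using LIMSEQ_unique [OF T [of "x + y"]] tendsto_add [OF T [of x] T [of y]] by (simp add: add)
  have TC: "T (c *\<^sub>C x) = c *\<^sub>C T x" for c x
    using LIMSEQ_unique [OF T [of "c *\<^sub>C x"]]
      bounded_linear.tendsto [OF bounded_linear_scaleC T [of x], of c] by (simp add: lin)
  have Tbd: "norm (T x) \<le> norm x * K" for x
  proof (rule tendsto_upperbound [OF tendsto_norm [OF T]])
    show "\<forall>\<^sub>F n in sequentially. norm (hs_apply (X n) x) \<le> norm x * K"
      by (rule always_eventually, rule allI, rule order_trans [OF norm_hs_apply_le])
        (simp add: mult.commute [of "norm (X _)"] mult_left_mono K)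
  qed simp
  have bT: "bounded_clinear T"
    unfolding bounded_clinear_def
    by (intro conjI allI bounded_linear_intro [of _ K]) (simp_all add: Tadd TC Tbd scaleR_scaleC)
  have fin: "(\<Sum>e\<in>F. (norm (T e - hs_apply (X n) e))\<^sup>2) \<le> d\<^sup>2"
    if F: "finite F" "F \<subseteq> E" and d: "\<And>m. m \<ge> N \<Longrightarrow> norm (X m - X n) \<le> d" for F n d N
  proof (rule tendsto_upperbound)
    show "(\<lambda>m. \<Sum>e\<in>F. (norm (hs_apply (X m) e - hs_apply (X n) e))\<^sup>2)
        \<longlonglongrightarrow> (\<Sum>e\<in>F. (norm (T e - hs_apply (X n) e))\<^sup>2)"
      by (intro tendsto_intros T)
    have "(\<Sum>e\<in>F. (norm (hs_apply (X m) e - hs_apply (X n) e))\<^sup>2) \<le> d\<^sup>2" if "m \<ge> N" for m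
    proof -
      have "(\<Sum>e\<in>F. (norm (hs_apply (X m - X n) e))\<^sup>2) \<le> (norm (X m - X n))\<^sup>2"
        by (rule finite_sum_le_has_sum [OF has_sum_norm_hs [OF E] F]) simp
      also have "\<dots> \<le> d\<^sup>2"
        using d [OF that] by (simp add: power_mono)
      finally show ?thesis by (simp add: hs_apply_simps)
    qed
    thus "\<forall>\<^sub>F m in sequentially. (\<Sum>e\<in>F. (norm (hs_apply (X m) e - hs_apply (X n) e))\<^sup>2) \<le> d\<^sup>2"
      using eventually_sequentially by blast
  qed simp
  have bD: "bounded_clinear (\<lambda>x. T x - hs_apply (X n) x)" for n
    using bounded_clinear_add [OF bT bounded_clinear_scaleC [OF hs_apply_bounded_clinear [of "X n"], of "-1"]]
    by simp
  have "\<exists>N. \<forall>n\<ge>N. hilbert_schmidt (\<lambda>x. T x - hs_apply (X n) x) \<and>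
      (\<forall>A. hs_apply A = (\<lambda>x. T x - hs_apply (X n) x) \<longrightarrow> norm A \<le> d)" if "d > 0" for d
  proof -
    obtain N where N: "\<And>m n. m \<ge> N \<Longrightarrow> n \<ge> N \<Longrightarrow> norm (X m - X n) < d"
      using XC [OF \<open>d > 0\<close>] by blast
    have "hilbert_schmidt (\<lambda>x. T x - hs_apply (X n) x) \<and>
      (\<forall>A. hs_apply A = (\<lambda>x. T x - hs_apply (X n) x) \<longrightarrow> norm A \<le> d)" if n: "n \<ge> N" for n
    proof -
      have le: "(\<Sum>e\<in>F. (norm (T e - hs_apply (X n) e))\<^sup>2) \<le> d\<^sup>2" if "finite F" "F \<subseteq> E" for F
        using that N n by (intro fin [of F N n d]) (auto intro: less_imp_le)
      have "(\<lambda>e. (norm (T e - hs_apply (X n) e))\<^sup>2) summable_on E"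
        by (rule nonneg_bdd_above_summable_on) (auto intro!: bdd_aboveI2 [of _ _ "d\<^sup>2"] le)
      hence "hilbert_schmidt (\<lambda>x. T x - hs_apply (X n) x)"
        using bD E unfolding hilbert_schmidt_def by blast
      moreover have "norm A \<le> d" if A: "hs_apply A = (\<lambda>x. T x - hs_apply (X n) x)" for A
      proof -
        have "(norm A)\<^sup>2 \<le> d\<^sup>2"
          by (rule has_sum_le_finite_sums [OF has_sum_norm_hs [OF E, of A]]) (simp add: A le)
        thus ?thesis by (rule power2_le_imp_le) (use \<open>d > 0\<close> in simp)
      qed
      ultimately show ?thesis by blast
    qed
    thus ?thesis by blast
  qed
  note close = this
  obtain N where "hilbert_schmidt (\<lambda>x. T x - hs_apply (X N) x)"
    using close [of 1] by auto
  from hilbert_schmidt_add [OF this hs_apply_hs [of "X N"]] have "hilbert_schmidt T"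
    by simp
  then obtain A where A: "hs_apply A = T"
    using hs_apply_cases by (metis mem_Collect_eq Abs_hs_op_inverse)
  have "X \<longlonglongrightarrow> A"
  proof (rule LIMSEQ_I)
    fix d :: real assume "d > 0"
    then obtain N where N: "\<And>n B. n \<ge> N \<Longrightarrow> hs_apply B = (\<lambda>x. T x - hs_apply (X n) x) \<Longrightarrow> norm B \<le> d/2"
      using close [of "d/2"] by auto
    have "norm (X n - A) < d" if "n \<ge> N" for n
    proof -
      have "norm (A - X n) \<le> d/2"
        by (rule N [OF that]) (simp add: fun_eq_iff hs_apply_simps A)
      thus ?thesis using \<open>d > 0\<close> by (simp add: norm_minus_commute)
    qed
    thus "\<exists>N. \<forall>n\<ge>N. norm (X n - A) < d" by blast
  qed
  thus "convergent X"
    unfolding convergent_def by blast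
qed

instance hs_op :: (complex_hilbert_space) complex_hilbert_space ..

instance hs_op :: (complex_hilbert_space) complex_banach_algebra ..

section \<open>Dual spaces and Arens regularity\<close>

typedef (overloaded) 'a cdual = "{f :: 'a::complex_normed_vector \<Rightarrow> complex. bounded_clinear f}"
  morphisms cdual_apply Abs_cdual
  using bounded_clinear_zero by blast

setup_lifting type_definition_cdual

lemma bounded_clinear_diff:
  "bounded_clinear S \<Longrightarrow> bounded_clinear T \<Longrightarrow> bounded_clinear (\<lambda>x. S x - T x)"
  by (simp add: bounded_clinear_def complex_vector.scale_right_diff_distrib bounded_linear_sub)

lemma bounded_clinear_minus:
  "bounded_clinear T \<Longrightarrow> bounded_clinear (\<lambda>x. - T x)"
  by (simp add: bounded_clinear_def bounded_linear_minus)

instantiation cdual :: (complex_normed_vector) complex_normed_vector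
begin

lift_definition zero_cdual :: "'a cdual" is "\<lambda>x. 0"
  by (rule bounded_clinear_zero)

lift_definition plus_cdual :: "'a cdual \<Rightarrow> 'a cdual \<Rightarrow> 'a cdual" is "\<lambda>f g x. f x + g x"
  by (rule bounded_clinear_add)

lift_definition minus_cdual :: "'a cdual \<Rightarrow> 'a cdual \<Rightarrow> 'a cdual" is "\<lambda>f g x. f x - g x"
  by (rule bounded_clinear_diff)

lift_definition uminus_cdual :: "'a cdual \<Rightarrow> 'a cdual" is "\<lambda>f x. - f x"
  by (rule bounded_clinear_minus)

lift_definition scaleC_cdual :: "complex \<Rightarrow> 'a cdual \<Rightarrow> 'a cdual" is "\<lambda>c f x. c *\<^sub>C f x"
  by (rule bounded_clinear_scaleC)

definition scaleR_cdual :: "real \<Rightarrow> 'a cdual \<Rightarrow> 'a cdual"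
  where "scaleR_cdual r f = complex_of_real r *\<^sub>C f"

lift_definition norm_cdual :: "'a cdual \<Rightarrow> real" is onorm .

definition dist_cdual :: "'a cdual \<Rightarrow> 'a cdual \<Rightarrow> real"
  where "dist_cdual f g = norm (f - g)"

definition sgn_cdual :: "'a cdual \<Rightarrow> 'a cdual"
  where "sgn_cdual f = scaleR (inverse (norm f)) f"

definition uniformity_cdual :: "('a cdual \<times> 'a cdual) filter"
  where "uniformity_cdual = (INF e\<in>{0 <..}. principal {(x, y). dist x y < e})"

definition open_cdual :: "'a cdual set \<Rightarrow> bool"
  where "open_cdual U = (\<forall>x\<in>U. \<forall>\<^sub>F (x', y) in uniformity. x' = x \<longrightarrow> y \<in> U)"

instance
proof
  fix f g h :: "'a cdual" and a b :: complex and r q :: real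
  show "f + g + h = f + (g + h)" by transfer (simp add: add.assoc)
  show "f + g = g + f" by transfer (simp add: add.commute)
  show "0 + f = f" by transfer simp
  show "- f + f = 0" by transfer simp
  show "f - g = f + - g" by transfer simp
  show "a *\<^sub>C (f + g) = a *\<^sub>C f + a *\<^sub>C g" by transfer (simp add: algebra_simps)
  show "(a + b) *\<^sub>C f = a *\<^sub>C f + b *\<^sub>C f" by transfer (simp add: algebra_simps)
  show "a *\<^sub>C (b *\<^sub>C f) = (a * b) *\<^sub>C f" by transfer (simp add: mult.assoc)
  show "r *\<^sub>R f = complex_of_real r *\<^sub>C f" by (rule scaleR_cdual_def)
  show "r *\<^sub>R (f + g) = r *\<^sub>R f + r *\<^sub>R g"
    unfolding scaleR_cdual_def by transfer (simp add: algebra_simps)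
  show "(r + q) *\<^sub>R f = r *\<^sub>R f + q *\<^sub>R f"
    unfolding scaleR_cdual_def by transfer (simp add: algebra_simps)
  show "r *\<^sub>R (q *\<^sub>R f) = (r * q) *\<^sub>R f"
    unfolding scaleR_cdual_def by transfer (simp add: mult.assoc)
  show "1 *\<^sub>R f = f"
    unfolding scaleR_cdual_def by transfer simp
  show "dist f g = norm (f - g)"
    by (rule dist_cdual_def)
  show "sgn f = scaleR (inverse (norm f)) f"
    by (rule sgn_cdual_def)
  show "(uniformity :: ('a cdual \<times> 'a cdual) filter) = (INF e\<in>{0 <..}. principal {(x, y). dist x y < e})"
    by (rule uniformity_cdual_def)
  show "open U = (\<forall>x\<in>U. \<forall>\<^sub>F (x', y) in uniformity. x' = x \<longrightarrow> y \<in> U)" for U :: "'a cdual set"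
    by (rule open_cdual_def)
  show "norm f = 0 \<longleftrightarrow> f = 0"
    by transfer (simp add: fun_eq_iff onorm_eq_0 bounded_clinear_def)
  show "norm (f + g) \<le> norm f + norm g"
    by transfer (simp add: onorm_triangle bounded_clinear_def)
  show nC: "norm (a *\<^sub>C f) = cmod a * norm f" for a
  proof -
    have le: "norm (c *\<^sub>C f) \<le> cmod c * norm f" for c and f :: "'a cdual"
    proof -
      have bl: "bounded_linear (cdual_apply f)"
        using cdual_apply [of f] by (simp add: bounded_clinear_def)
      show ?thesis
        unfolding norm_cdual.rep_eq scaleC_cdual.rep_eq
      proof (rule onorm_bound)
        show "norm (c *\<^sub>C cdual_apply f x) \<le> cmod c * onorm (cdual_apply f) * norm x" for x
          using onorm [OF bl, of x] by (simp add: norm_mult mult.assoc mult_left_mono)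
        show "0 \<le> cmod c * onorm (cdual_apply f)"
          using onorm_pos_le [OF bl] by simp
      qed
    qed
    show ?thesis
    proof (cases "a = 0")
      case True
      have "(0::complex) *\<^sub>C f = 0" by transfer simp
      moreover have "norm (0 :: 'a cdual) = 0" by transfer (simp add: onorm_zero)
      ultimately show ?thesis using True by simp
    next
      case False
      have "inverse a *\<^sub>C (a *\<^sub>C f) = f"
        using False by transfer (simp add: mult.assoc [symmetric])
      hence "norm f \<le> cmod (inverse a) * norm (a *\<^sub>C f)"
        using le [of "inverse a" "a *\<^sub>C f"] by simp
      hence "cmod a * norm f \<le> norm (a *\<^sub>C f)"
        using False by (simp add: norm_inverse norm_divide field_simps)
      with le [of a f] show ?thesis by simp
    qed
  qed
  show "norm (r *\<^sub>R f) = \<bar>r\<bar> * norm f"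
    by (simp add: scaleR_cdual_def nC)
qed

end

lemmas cdual_apply_simps = zero_cdual.rep_eq plus_cdual.rep_eq minus_cdual.rep_eq
  uminus_cdual.rep_eq scaleC_cdual.rep_eq

lemma cdual_eqI: "(\<And>x. cdual_apply f x = cdual_apply g x) \<Longrightarrow> f = g"
  by (rule cdual_apply_inject [THEN iffD1, OF ext])

lemma cdual_apply_add: "cdual_apply f (x + y) = cdual_apply f x + cdual_apply f y"
  using cdual_apply [of f] linear_add [OF bounded_linear.linear] by (auto simp: bounded_clinear_def)

lemma cdual_apply_scaleC: "cdual_apply f (c *\<^sub>C x) = c * cdual_apply f x"
  using cdual_apply [of f] by (auto simp: bounded_clinear_def)

lemma cdual_apply_le: "cmod (cdual_apply f x) \<le> norm f * norm x"
  by transfer (simp add: onorm bounded_clinear_def)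

lemma cdual_norm_leI:
  "(\<And>x. cmod (cdual_apply f x) \<le> K * norm x) \<Longrightarrow> 0 \<le> K \<Longrightarrow> norm f \<le> K"
  by transfer (rule onorm_bound)

lemma bounded_clinear_functionalI:
  fixes f :: "'a::complex_normed_vector \<Rightarrow> complex"
  assumes "\<And>x y. f (x + y) = f x + f y" "\<And>c x. f (c *\<^sub>C x) = c * f x"
    and "\<And>x. cmod (f x) \<le> K * norm x"
  shows "bounded_clinear f"
  unfolding bounded_clinear_def
  by (intro conjI allI bounded_linear_intro [of _ K])
    (simp_all add: assms scaleR_scaleC mult.commute [of "norm _" K] scaleR_conv_of_real)

text \<open>
  For an element $a$, a functional $\omega$ and bidual elements $f, g$: \<open>dual_lmult \<omega> a\<close> is
  $\omega_a = \omega(a\,\cdot)$, \<open>dual_rmult \<omega> a\<close> is ${}_a\omega = \omega(\cdot\,a)$,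
  \<open>bidual_lmult \<omega> f\<close> is $\omega_f$ and \<open>bidual_rmult \<omega> f\<close> is ${}_f\omega$;
  \<open>arens_box\<close> and \<open>arens_diamond\<close> are the two Arens products.  The lemmas \<open>*_apply\<close> show that the
  functions handed to \<open>Abs_cdual\<close> are indeed bounded functionals.\<close>

definition dual_lmult :: "'a::complex_normed_algebra cdual \<Rightarrow> 'a \<Rightarrow> 'a cdual"
  where "dual_lmult \<omega> a = Abs_cdual (\<lambda>b. cdual_apply \<omega> (a * b))"

definition dual_rmult :: "'a::complex_normed_algebra cdual \<Rightarrow> 'a \<Rightarrow> 'a cdual"
  where "dual_rmult \<omega> a = Abs_cdual (\<lambda>b. cdual_apply \<omega> (b * a))"

definition bidual_lmult :: "'a::complex_normed_algebra cdual \<Rightarrow> 'a cdual cdual \<Rightarrow> 'a cdual"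
  where "bidual_lmult \<omega> f = Abs_cdual (\<lambda>a. cdual_apply f (dual_rmult \<omega> a))"

definition bidual_rmult :: "'a::complex_normed_algebra cdual \<Rightarrow> 'a cdual cdual \<Rightarrow> 'a cdual"
  where "bidual_rmult \<omega> f = Abs_cdual (\<lambda>a. cdual_apply f (dual_lmult \<omega> a))"

definition arens_box :: "'a::complex_normed_algebra cdual cdual \<Rightarrow> 'a cdual cdual \<Rightarrow> 'a cdual cdual"
  where "arens_box f g = Abs_cdual (\<lambda>\<omega>. cdual_apply f (bidual_rmult \<omega> g))"

definition arens_diamond :: "'a::complex_normed_algebra cdual cdual \<Rightarrow> 'a cdual cdual \<Rightarrow> 'a cdual cdual"
  where "arens_diamond f g = Abs_cdual (\<lambda>\<omega>. cdual_apply g (bidual_lmult \<omega> f))"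

definition arens_regular :: "'a::complex_normed_algebra itself \<Rightarrow> bool"
  where "arens_regular (A :: 'a itself) \<longleftrightarrow>
    (\<forall>f g :: 'a cdual cdual. arens_box f g = arens_diamond f g)"

lemma cdual_apply_mult_le:
  fixes a b :: "'a::complex_normed_algebra"
  shows "cmod (cdual_apply \<omega> (a * b)) \<le> norm \<omega> * (norm a * norm b)"
  using cdual_apply_le [of \<omega> "a * b"] mult_left_mono [OF norm_mult_ineq [of a b] norm_ge_zero [of \<omega>]]
  by linarith

lemma dual_lmult_apply: "cdual_apply (dual_lmult \<omega> a) b = cdual_apply \<omega> (a * b)"
proof -
  have "bounded_clinear (\<lambda>b. cdual_apply \<omega> (a * b))"
    by (rule bounded_clinear_functionalI [where K = "norm \<omega> * norm a"])
      (simp_all add: distrib_left cdual_apply_add mult_scaleC_right cdual_apply_scaleC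
        cdual_apply_mult_le mult.assoc)
  thus ?thesis by (simp add: dual_lmult_def Abs_cdual_inverse)
qed

lemma dual_rmult_apply: "cdual_apply (dual_rmult \<omega> a) b = cdual_apply \<omega> (b * a)"
proof -
  have "bounded_clinear (\<lambda>b. cdual_apply \<omega> (b * a))"
  proof (rule bounded_clinear_functionalI [where K = "norm \<omega> * norm a"])
    show "cmod (cdual_apply \<omega> (b * a)) \<le> norm \<omega> * norm a * norm b" for b
      using cdual_apply_mult_le [of \<omega> b a] by (simp add: mult.assoc mult.commute [of "norm b"])
  qed (simp_all add: distrib_right cdual_apply_add mult_scaleC_left cdual_apply_scaleC)
  thus ?thesis by (simp add: dual_rmult_def Abs_cdual_inverse)
qed

lemma norm_dual_lmult_le: "norm (dual_lmult \<omega> a) \<le> norm \<omega> * norm a"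
  by (rule cdual_norm_leI) (simp_all add: dual_lmult_apply mult.assoc cdual_apply_mult_le)

lemma norm_dual_rmult_le: "norm (dual_rmult \<omega> a) \<le> norm \<omega> * norm a"
proof (rule cdual_norm_leI)
  show "cmod (cdual_apply (dual_rmult \<omega> a) b) \<le> norm \<omega> * norm a * norm b" for b
    using cdual_apply_mult_le [of \<omega> b a]
    by (simp add: dual_rmult_apply mult.assoc mult.commute [of "norm b"])
qed simp

lemma bidual_lmult_apply: "cdual_apply (bidual_lmult \<omega> f) a = cdual_apply f (dual_rmult \<omega> a)"
proof -
  have add: "dual_rmult \<omega> (a + b) = dual_rmult \<omega> a + dual_rmult \<omega> b" for a b
    by (rule cdual_eqI) (simp add: dual_rmult_apply cdual_apply_simps distrib_left cdual_apply_add)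
  have scale: "dual_rmult \<omega> (c *\<^sub>C a) = c *\<^sub>C dual_rmult \<omega> a" for c a
    by (rule cdual_eqI) (simp add: dual_rmult_apply cdual_apply_simps mult_scaleC_right cdual_apply_scaleC)
  have "bounded_clinear (\<lambda>a. cdual_apply f (dual_rmult \<omega> a))"
  proof (rule bounded_clinear_functionalI [where K = "norm f * norm \<omega>"])
    show "cmod (cdual_apply f (dual_rmult \<omega> a)) \<le> norm f * norm \<omega> * norm a" for a
      using order_trans [OF cdual_apply_le mult_left_mono [OF norm_dual_rmult_le norm_ge_zero]]
      by (simp add: mult.assoc)
  qed (simp_all add: add scale cdual_apply_add cdual_apply_scaleC)
  thus ?thesis by (simp add: bidual_lmult_def Abs_cdual_inverse)
qed

lemma bidual_rmult_apply: "cdual_apply (bidual_rmult \<omega> f) a = cdual_apply f (dual_lmult \<omega> a)"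
proof -
  have add: "dual_lmult \<omega> (a + b) = dual_lmult \<omega> a + dual_lmult \<omega> b" for a b
    by (rule cdual_eqI) (simp add: dual_lmult_apply cdual_apply_simps distrib_right cdual_apply_add)
  have scale: "dual_lmult \<omega> (c *\<^sub>C a) = c *\<^sub>C dual_lmult \<omega> a" for c a
    by (rule cdual_eqI) (simp add: dual_lmult_apply cdual_apply_simps mult_scaleC_left cdual_apply_scaleC)
  have "bounded_clinear (\<lambda>a. cdual_apply f (dual_lmult \<omega> a))"
  proof (rule bounded_clinear_functionalI [where K = "norm f * norm \<omega>"])
    show "cmod (cdual_apply f (dual_lmult \<omega> a)) \<le> norm f * norm \<omega> * norm a" for a
      using order_trans [OF cdual_apply_le mult_left_mono [OF norm_dual_lmult_le norm_ge_zero]]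
      by (simp add: mult.assoc)
  qed (simp_all add: add scale cdual_apply_add cdual_apply_scaleC)
  thus ?thesis by (simp add: bidual_rmult_def Abs_cdual_inverse)
qed

lemma norm_bidual_lmult_le: "norm (bidual_lmult \<omega> f) \<le> norm f * norm \<omega>"
proof (rule cdual_norm_leI)
  show "cmod (cdual_apply (bidual_lmult \<omega> f) a) \<le> norm f * norm \<omega> * norm a" for a
    using order_trans [OF cdual_apply_le mult_left_mono [OF norm_dual_rmult_le norm_ge_zero]]
    by (simp add: mult.assoc bidual_lmult_apply)
qed simp

lemma norm_bidual_rmult_le: "norm (bidual_rmult \<omega> f) \<le> norm f * norm \<omega>"
proof (rule cdual_norm_leI)
  show "cmod (cdual_apply (bidual_rmult \<omega> f) a) \<le> norm f * norm \<omega> * norm a" for a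
    using order_trans [OF cdual_apply_le mult_left_mono [OF norm_dual_lmult_le norm_ge_zero]]
    by (simp add: mult.assoc bidual_rmult_apply)
qed simp

lemma arens_box_apply: "cdual_apply (arens_box f g) \<omega> = cdual_apply f (bidual_rmult \<omega> g)"
proof -
  have add: "bidual_rmult (\<omega> + \<omega>') g = bidual_rmult \<omega> g + bidual_rmult \<omega>' g" for \<omega> \<omega>'
  proof (rule cdual_eqI)
    have "dual_lmult (\<omega> + \<omega>') a = dual_lmult \<omega> a + dual_lmult \<omega>' a" for a
      by (rule cdual_eqI) (simp add: dual_lmult_apply cdual_apply_simps)
    thus "cdual_apply (bidual_rmult (\<omega> + \<omega>') g) a
        = cdual_apply (bidual_rmult \<omega> g + bidual_rmult \<omega>' g) a" for a
      by (simp add: bidual_rmult_apply cdual_apply_simps cdual_apply_add)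
  qed
  have scale: "bidual_rmult (c *\<^sub>C \<omega>) g = c *\<^sub>C bidual_rmult \<omega> g" for c \<omega>
  proof (rule cdual_eqI)
    have "dual_lmult (c *\<^sub>C \<omega>) a = c *\<^sub>C dual_lmult \<omega> a" for a
      by (rule cdual_eqI) (simp add: dual_lmult_apply cdual_apply_simps)
    thus "cdual_apply (bidual_rmult (c *\<^sub>C \<omega>) g) a = cdual_apply (c *\<^sub>C bidual_rmult \<omega> g) a" for a
      by (simp add: bidual_rmult_apply cdual_apply_simps cdual_apply_scaleC)
  qed
  have "bounded_clinear (\<lambda>\<omega>. cdual_apply f (bidual_rmult \<omega> g))"
  proof (rule bounded_clinear_functionalI [where K = "norm f * norm g"])
    show "cmod (cdual_apply f (bidual_rmult \<omega> g)) \<le> norm f * norm g * norm \<omega>" for \<omega>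
      using order_trans [OF cdual_apply_le mult_left_mono [OF norm_bidual_rmult_le norm_ge_zero]]
      by (simp add: mult.assoc)
  qed (simp_all add: add scale cdual_apply_add cdual_apply_scaleC)
  thus ?thesis by (simp add: arens_box_def Abs_cdual_inverse)
qed

lemma arens_diamond_apply: "cdual_apply (arens_diamond f g) \<omega> = cdual_apply g (bidual_lmult \<omega> f)"
proof -
  have add: "bidual_lmult (\<omega> + \<omega>') f = bidual_lmult \<omega> f + bidual_lmult \<omega>' f" for \<omega> \<omega>'
  proof (rule cdual_eqI)
    have "dual_rmult (\<omega> + \<omega>') a = dual_rmult \<omega> a + dual_rmult \<omega>' a" for a
      by (rule cdual_eqI) (simp add: dual_rmult_apply cdual_apply_simps)
    thus "cdual_apply (bidual_lmult (\<omega> + \<omega>') f) a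
        = cdual_apply (bidual_lmult \<omega> f + bidual_lmult \<omega>' f) a" for a
      by (simp add: bidual_lmult_apply cdual_apply_simps cdual_apply_add)
  qed
  have scale: "bidual_lmult (c *\<^sub>C \<omega>) f = c *\<^sub>C bidual_lmult \<omega> f" for c \<omega>
  proof (rule cdual_eqI)
    have "dual_rmult (c *\<^sub>C \<omega>) a = c *\<^sub>C dual_rmult \<omega> a" for a
      by (rule cdual_eqI) (simp add: dual_rmult_apply cdual_apply_simps)
    thus "cdual_apply (bidual_lmult (c *\<^sub>C \<omega>) f) a = cdual_apply (c *\<^sub>C bidual_lmult \<omega> f) a" for a
      by (simp add: bidual_lmult_apply cdual_apply_simps cdual_apply_scaleC)
  qed
  have "bounded_clinear (\<lambda>\<omega>. cdual_apply g (bidual_lmult \<omega> f))"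
  proof (rule bounded_clinear_functionalI [where K = "norm g * norm f"])
    show "cmod (cdual_apply g (bidual_lmult \<omega> f)) \<le> norm g * norm f * norm \<omega>" for \<omega>
      using order_trans [OF cdual_apply_le mult_left_mono [OF norm_bidual_lmult_le norm_ge_zero]]
      by (simp add: mult.assoc)
  qed (simp_all add: add scale cdual_apply_add cdual_apply_scaleC)
  thus ?thesis by (simp add: arens_diamond_def Abs_cdual_inverse)
qed

section \<open>The projective tensor product\<close>

text \<open>A list \<open>[(x\<^sub>1, y\<^sub>1), \<dots>, (x\<^sub>n, y\<^sub>n)]\<close> stands for the formal sum $\sum_i x_i \otimes y_i$.  The algebraic
  tensor product is the set of formal sums modulo the least congruence that makes $\otimes$ bilinear;
  additive inverses exist in the quotient because $(-x) \otimes y + x \otimes y = 0 \otimes y = 0$.\<close>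

inductive tensor_eq :: "('a::complex_vector \<times> 'b::complex_vector) list \<Rightarrow> ('a \<times> 'b) list \<Rightarrow> bool"
  (infix "\<approx>\<^sub>T" 50) where
  refl: "xs \<approx>\<^sub>T xs"
| sym: "xs \<approx>\<^sub>T ys \<Longrightarrow> ys \<approx>\<^sub>T xs"
| trans: "xs \<approx>\<^sub>T ys \<Longrightarrow> ys \<approx>\<^sub>T zs \<Longrightarrow> xs \<approx>\<^sub>T zs"
| append: "xs \<approx>\<^sub>T xs' \<Longrightarrow> ys \<approx>\<^sub>T ys' \<Longrightarrow> xs @ ys \<approx>\<^sub>T xs' @ ys'"
| commute: "xs @ ys \<approx>\<^sub>T ys @ xs"
| add_left: "[(x + x', y)] \<approx>\<^sub>T [(x, y), (x', y)]"
| add_right: "[(x, y + y')] \<approx>\<^sub>T [(x, y), (x, y')]"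
| scale: "[(c *\<^sub>C x, y)] \<approx>\<^sub>T [(x, c *\<^sub>C y)]"
| zero: "[(0, y)] \<approx>\<^sub>T []"

quotient_type (overloaded) ('a, 'b) alg_tensor =
  "('a::complex_vector \<times> 'b::complex_vector) list" / tensor_eq
  by (intro equivpI reflpI sympI transpI) (blast intro: tensor_eq.refl tensor_eq.sym tensor_eq.trans)+

lemma tensor_eq_perm: "mset xs = mset ys \<Longrightarrow> xs \<approx>\<^sub>T ys"
proof (induction xs arbitrary: ys)
  case Nil
  thus ?case by (simp add: tensor_eq.refl)
next
  case (Cons p xs)
  have "p \<in> set ys"
    using Cons.prems by (metis list.set_intros(1) mset_eq_setD)
  then obtain us vs where ys: "ys = us @ p # vs"
    by (meson split_list)
  have "xs \<approx>\<^sub>T us @ vs"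
    using Cons.prems ys by (intro Cons.IH) simp
  hence "[p] @ xs \<approx>\<^sub>T [p] @ (us @ vs)"
    by (intro tensor_eq.append tensor_eq.refl)
  moreover have "([p] @ us) @ vs \<approx>\<^sub>T (us @ [p]) @ vs"
    by (rule tensor_eq.append [OF tensor_eq.commute tensor_eq.refl])
  ultimately show ?case
    using ys tensor_eq.trans by fastforce
qed

lemma tensor_eq_zero_right: "[(x, 0)] \<approx>\<^sub>T []"
  using tensor_eq.sym [OF tensor_eq.scale [of 0 x 0]] tensor_eq.zero [of 0] tensor_eq.trans by fastforce

lemma tensor_eq_map:
  assumes "\<And>p. [f p] \<approx>\<^sub>T [g p]"
  shows "map f xs \<approx>\<^sub>T map g xs"
proof (induction xs)
  case (Cons p xs)
  show ?case using tensor_eq.append [OF assms Cons.IH, of p] by simp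
qed (simp add: tensor_eq.refl)

lemma tensor_eq_map_add:
  assumes "\<And>p. [f p] \<approx>\<^sub>T [g p, h p]"
  shows "map f xs \<approx>\<^sub>T map g xs @ map h xs"
proof (induction xs)
  case (Cons p xs)
  have "map f (p # xs) \<approx>\<^sub>T [g p, h p] @ map g xs @ map h xs"
    using tensor_eq.append [OF assms Cons.IH, of p] by simp
  moreover have "[g p, h p] @ map g xs @ map h xs \<approx>\<^sub>T map g (p # xs) @ map h (p # xs)"
    by (rule tensor_eq_perm) simp
  ultimately show ?case by (rule tensor_eq.trans)
qed (simp add: tensor_eq.refl)

text \<open>A map on elementary tensors that respects the generating relations respects \<open>\<approx>\<^sub>T\<close>.\<close>

lemma tensor_eq_map_cong:
  assumes "xs \<approx>\<^sub>T ys"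
    and "\<And>x x' y. [f (x + x', y)] \<approx>\<^sub>T [f (x, y), f (x', y)]"
    and "\<And>x y y'. [f (x, y + y')] \<approx>\<^sub>T [f (x, y), f (x, y')]"
    and "\<And>c x y. [f (c *\<^sub>C x, y)] \<approx>\<^sub>T [f (x, c *\<^sub>C y)]"
    and "\<And>y. [f (0, y)] \<approx>\<^sub>T []"
  shows "map f xs \<approx>\<^sub>T map f ys"
  using assms(1)
proof induction
  case (trans xs ys zs)
  show ?case by (rule tensor_eq.trans [OF trans.IH])
qed (simp_all add: assms tensor_eq.refl tensor_eq.sym tensor_eq.append tensor_eq.commute)

instantiation alg_tensor :: (complex_vector, complex_vector) complex_vector
begin

lift_definition zero_alg_tensor :: "('a, 'b) alg_tensor" is "[]" .

lift_definition plus_alg_tensor :: "('a, 'b) alg_tensor \<Rightarrow> ('a, 'b) alg_tensor \<Rightarrow> ('a, 'b) alg_tensor"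
  is "(@)"
  by (rule tensor_eq.append)

lift_definition scaleC_alg_tensor :: "complex \<Rightarrow> ('a, 'b) alg_tensor \<Rightarrow> ('a, 'b) alg_tensor"
  is "\<lambda>c. map (\<lambda>(x, y). (c *\<^sub>C x, y))"
proof -
  fix c :: complex and xs ys :: "('a \<times> 'b) list"
  assume "xs \<approx>\<^sub>T ys"
  thus "map (\<lambda>(x, y). (c *\<^sub>C x, y)) xs \<approx>\<^sub>T map (\<lambda>(x, y). (c *\<^sub>C x, y)) ys"
  proof (rule tensor_eq_map_cong)
    show "[case (d *\<^sub>C x, y) of (x, y) \<Rightarrow> (c *\<^sub>C x, y)] \<approx>\<^sub>T [case (x, d *\<^sub>C y) of (x, y) \<Rightarrow> (c *\<^sub>C x, y)]"
      for d and x :: 'a and y :: 'b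
      using tensor_eq.scale [of d "c *\<^sub>C x" y] by (simp add: scaleC_scaleC mult.commute)
  qed (simp_all add: scaleC_add_right tensor_eq.intros)
qed

definition scaleR_alg_tensor :: "real \<Rightarrow> ('a, 'b) alg_tensor \<Rightarrow> ('a, 'b) alg_tensor"
  where "scaleR_alg_tensor r u = complex_of_real r *\<^sub>C u"

definition uminus_alg_tensor :: "('a, 'b) alg_tensor \<Rightarrow> ('a, 'b) alg_tensor"
  where "uminus_alg_tensor u = (-1) *\<^sub>C u"

definition minus_alg_tensor :: "('a, 'b) alg_tensor \<Rightarrow> ('a, 'b) alg_tensor \<Rightarrow> ('a, 'b) alg_tensor"
  where "minus_alg_tensor u v = u + - v"

instance
proof
  fix u v w :: "('a, 'b) alg_tensor" and a b :: complex and r q :: real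
  show assoc: "u + v + w = u + (v + w)" for u v w :: "('a, 'b) alg_tensor"
    by transfer (simp add: tensor_eq.refl)
  show comm: "u + v = v + u" for u v :: "('a, 'b) alg_tensor"
    by transfer (rule tensor_eq.commute)
  show "0 + u = u" by transfer (simp add: tensor_eq.refl)
  show sr: "a *\<^sub>C (u + v) = a *\<^sub>C u + a *\<^sub>C v" for a and u v :: "('a, 'b) alg_tensor"
    by transfer (simp add: tensor_eq.refl)
  show sl: "(a + b) *\<^sub>C u = a *\<^sub>C u + b *\<^sub>C u" for a b
    by transfer (rule tensor_eq_map_add, auto simp: scaleC_add_left intro: tensor_eq.add_left)
  show ss: "a *\<^sub>C (b *\<^sub>C u) = (a * b) *\<^sub>C u" for a b
    by transfer (simp add: scaleC_scaleC comp_def case_prod_unfold tensor_eq.refl)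
  have one: "1 *\<^sub>C u = u" for u :: "('a, 'b) alg_tensor"
    by transfer (simp add: case_prod_unfold tensor_eq.refl)
  have zero: "0 *\<^sub>C u = 0" for u :: "('a, 'b) alg_tensor"
  proof transfer
    fix xs :: "('a \<times> 'b) list"
    show "map (\<lambda>(x, y). (0 *\<^sub>C x, y)) xs \<approx>\<^sub>T []"
    proof (induction xs)
      case (Cons p xs)
      have "[(0, snd p)] @ map (\<lambda>(x, y). (0 *\<^sub>C x, y)) xs \<approx>\<^sub>T [] @ []"
        by (intro tensor_eq.append tensor_eq.zero Cons.IH)
      thus ?case by (simp add: case_prod_unfold)
    qed (simp add: tensor_eq.refl)
  qed
  show "- u + u = 0"
    using sl [of "-1" 1] by (simp add: uminus_alg_tensor_def one zero)
  show "u - v = u + - v"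
    by (rule minus_alg_tensor_def)
  show "r *\<^sub>R u = complex_of_real r *\<^sub>C u" by (rule scaleR_alg_tensor_def)
  show "r *\<^sub>R (u + v) = r *\<^sub>R u + r *\<^sub>R v"
    by (simp add: scaleR_alg_tensor_def sr)
  show "(r + q) *\<^sub>R u = r *\<^sub>R u + q *\<^sub>R u"
    by (simp add: scaleR_alg_tensor_def sl)
  show "r *\<^sub>R (q *\<^sub>R u) = (r * q) *\<^sub>R u"
    by (simp add: scaleR_alg_tensor_def ss)
  show "1 *\<^sub>R u = u"
    by (simp add: scaleR_alg_tensor_def one)
qed

end

definition tensor_mult :: "('a::times \<times> 'b::times) list \<Rightarrow> ('a \<times> 'b) list \<Rightarrow> ('a \<times> 'b) list"
  where "tensor_mult us vs = concat (map (\<lambda>(x1, y1). map (\<lambda>(x2, y2). (x1 * x2, y1 * y2)) vs) us)"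

lemma tensor_mult_Nil [simp]: "tensor_mult [] vs = []"
  by (simp add: tensor_mult_def)

lemma tensor_mult_Cons [simp]:
  "tensor_mult (p # us) vs = map (\<lambda>(x2, y2). (fst p * x2, snd p * y2)) vs @ tensor_mult us vs"
  by (simp add: tensor_mult_def case_prod_unfold)

lemma tensor_mult_append: "tensor_mult (us @ us') vs = tensor_mult us vs @ tensor_mult us' vs"
  by (induction us) simp_all

lemma mset_tensor_mult_append:
  "mset (tensor_mult us (vs @ vs')) = mset (tensor_mult us vs @ tensor_mult us vs')"
  by (induction us) simp_all

lemma mset_tensor_mult_Cons_right:
  "mset (tensor_mult us (q # vs)) = mset (map (\<lambda>(x1, y1). (x1 * fst q, y1 * snd q)) us @ tensor_mult us vs)"
  by (induction us) (auto simp: case_prod_unfold)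

lemma tensor_mult_assoc:
  fixes us :: "('a::semigroup_mult \<times> 'b::semigroup_mult) list"
  shows "tensor_mult (tensor_mult us vs) ws = tensor_mult us (tensor_mult vs ws)"
proof -
  have "tensor_mult (map (\<lambda>(x2, y2). (x * x2, y * y2)) vs) ws
      = map (\<lambda>(x2, y2). (x * x2, y * y2)) (tensor_mult vs ws)" for x :: 'a and y :: 'b
    by (induction vs) (auto simp: case_prod_unfold mult.assoc)
  thus ?thesis
    by (induction us) (simp_all add: tensor_mult_append)
qed

lemma tensor_mult_cong_right:
  fixes us :: "('a::complex_normed_algebra \<times> 'b::complex_normed_algebra) list"
  assumes "vs \<approx>\<^sub>T vs'"
  shows "tensor_mult us vs \<approx>\<^sub>T tensor_mult us vs'"
proof (induction us)
  case (Cons p us)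
  have "map (\<lambda>(x2, y2). (fst p * x2, snd p * y2)) vs \<approx>\<^sub>T map (\<lambda>(x2, y2). (fst p * x2, snd p * y2)) vs'"
    using assms
    by (rule tensor_eq_map_cong)
      (simp_all add: distrib_left mult_scaleC_right tensor_eq.intros)
  from tensor_eq.append [OF this Cons.IH] show ?case by simp
qed (simp add: tensor_eq.refl)

lemma tensor_mult_cong_left:
  fixes us :: "('a::complex_normed_algebra \<times> 'b::complex_normed_algebra) list"
  assumes "us \<approx>\<^sub>T us'"
  shows "tensor_mult us vs \<approx>\<^sub>T tensor_mult us' vs"
proof (induction vs)
  case (Cons q vs)
  let ?f = "\<lambda>(x1, y1). (x1 * fst q, y1 * snd q)"
  have "map ?f us \<approx>\<^sub>T map ?f us'"
    using assms
    by (rule tensor_eq_map_cong)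
      (simp_all add: distrib_right mult_scaleC_left tensor_eq.intros)
  hence "map ?f us @ tensor_mult us vs \<approx>\<^sub>T map ?f us' @ tensor_mult us' vs"
    using Cons.IH by (rule tensor_eq.append)
  thus ?case
    using tensor_eq_perm [OF mset_tensor_mult_Cons_right [of us q vs]]
      tensor_eq_perm [OF mset_tensor_mult_Cons_right [of us' q vs, symmetric]]
      tensor_eq.trans by blast
next
  case Nil
  have "tensor_mult ws [] = []" for ws :: "('a \<times> 'b) list"
    by (induction ws) simp_all
  thus ?case by (simp add: tensor_eq.refl)
qed

instantiation alg_tensor :: (complex_normed_algebra, complex_normed_algebra) real_algebra
begin

lift_definition times_alg_tensor :: "('a, 'b) alg_tensor \<Rightarrow> ('a, 'b) alg_tensor \<Rightarrow> ('a, 'b) alg_tensor"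
  is tensor_mult
  by (rule tensor_eq.trans [OF tensor_mult_cong_left tensor_mult_cong_right])

lemma alg_tensor_mult_scaleC:
  fixes u v :: "('a, 'b) alg_tensor"
  shows "(c *\<^sub>C u) * v = c *\<^sub>C (u * v)" "u * (c *\<^sub>C v) = c *\<^sub>C (u * v)"
proof -
  have "tensor_mult (map (\<lambda>(x, y). (c *\<^sub>C x, y)) us) vs = map (\<lambda>(x, y). (c *\<^sub>C x, y)) (tensor_mult us vs)"
    for us vs :: "('a \<times> 'b) list"
    by (induction us) (auto simp: case_prod_unfold mult_scaleC_left)
  thus "(c *\<^sub>C u) * v = c *\<^sub>C (u * v)"
    by transfer (simp add: tensor_eq.refl)
  have "tensor_mult us (map (\<lambda>(x, y). (c *\<^sub>C x, y)) vs) = map (\<lambda>(x, y). (c *\<^sub>C x, y)) (tensor_mult us vs)"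
    for us vs :: "('a \<times> 'b) list"
    by (induction us) (auto simp: case_prod_unfold mult_scaleC_right)
  thus "u * (c *\<^sub>C v) = c *\<^sub>C (u * v)"
    by transfer (simp add: tensor_eq.refl)
qed

instance
proof
  fix u v w :: "('a, 'b) alg_tensor" and r :: real
  show "u * v * w = u * (v * w)"
    by transfer (simp add: tensor_mult_assoc tensor_eq.refl)
  show "(u + v) * w = u * w + v * w"
    by transfer (simp add: tensor_mult_append tensor_eq.refl)
  show "u * (v + w) = u * v + u * w"
    by transfer (rule tensor_eq_perm [OF mset_tensor_mult_append])
  show "(r *\<^sub>R u) * v = r *\<^sub>R (u * v)" "u * (r *\<^sub>R v) = r *\<^sub>R (u * v)"
    by (simp_all add: scaleR_scaleC alg_tensor_mult_scaleC)
qed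

end

definition gamma_norm :: "('a::complex_normed_vector, 'b::complex_normed_vector) alg_tensor \<Rightarrow> real"
  where "gamma_norm u = Inf {\<Sum>(x, y)\<leftarrow>xs. norm x * norm y | xs. abs_alg_tensor xs = u}"

definition tensor_cost :: "('a::real_normed_vector \<times> 'b::real_normed_vector) list \<Rightarrow> real"
  where "tensor_cost xs = (\<Sum>(x, y)\<leftarrow>xs. norm x * norm y)"

lemma tensor_cost_simps:
  "tensor_cost [] = 0" "tensor_cost ((x, y) # xs) = norm x * norm y + tensor_cost xs"
  "tensor_cost (xs @ ys) = tensor_cost xs + tensor_cost ys"
  by (simp_all add: tensor_cost_def)

lemma tensor_cost_nonneg: "0 \<le> tensor_cost xs"
  by (induction xs) (auto simp: tensor_cost_simps)

lemma tensor_cost_mult: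
  fixes us vs :: "('a::real_normed_algebra \<times> 'b::real_normed_algebra) list"
  shows "tensor_cost (tensor_mult us vs) \<le> tensor_cost us * tensor_cost vs"
proof -
  have *: "tensor_cost (map (\<lambda>(x2, y2). (x * x2, y * y2)) vs) \<le> norm x * norm y * tensor_cost vs"
    for x :: 'a and y :: 'b
  proof (induction vs)
    case (Cons q vs)
    have "norm (x * fst q) * norm (y * snd q) \<le> (norm x * norm (fst q)) * (norm y * norm (snd q))"
      by (intro mult_mono norm_mult_ineq) simp_all
    with Cons.IH show ?case
      by (cases q) (simp add: tensor_cost_simps algebra_simps)
  qed (simp add: tensor_cost_simps)
  show ?thesis
  proof (induction us)
    case (Cons p us)
    with * [of "fst p" "snd p"] show ?case
      by (cases p) (simp add: tensor_cost_simps distrib_right)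
  qed (simp add: tensor_cost_simps)
qed

lemma gamma_norm_eq: "gamma_norm u = Inf {tensor_cost xs | xs. abs_alg_tensor xs = u}"
  by (simp add: gamma_norm_def tensor_cost_def)

lemma gamma_norm_le: "gamma_norm (abs_alg_tensor xs) \<le> tensor_cost xs"
  unfolding gamma_norm_eq
  by (rule cInf_lower) (auto intro!: bdd_belowI [of _ 0] simp: tensor_cost_nonneg)

lemma gamma_norm_nonneg: "0 \<le> gamma_norm u"
  unfolding gamma_norm_eq
proof (rule cInf_greatest)
  show "{tensor_cost xs | xs. abs_alg_tensor xs = u} \<noteq> {}"
    by (induction u) blast
qed (auto simp: tensor_cost_nonneg)

lemma gamma_norm_approx:
  assumes "e > 0"
  obtains xs where "abs_alg_tensor xs = u" "tensor_cost xs < gamma_norm u + e"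
proof -
  have ne: "{tensor_cost xs | xs. abs_alg_tensor xs = u} \<noteq> {}"
    by (induction u) blast
  have "Inf {tensor_cost xs | xs. abs_alg_tensor xs = u} < gamma_norm u + e"
    using assms by (simp add: gamma_norm_eq)
  from cInf_lessD [OF ne this] show ?thesis
    using that by blast
qed

lemma gamma_norm_zero [simp]: "gamma_norm 0 = 0"
proof (rule antisym)
  show "gamma_norm (0 :: ('a, 'b) alg_tensor) \<le> 0"
    using gamma_norm_le [of "[] :: ('a \<times> 'b) list"]
    by (simp add: tensor_cost_simps zero_alg_tensor_def)
qed (rule gamma_norm_nonneg)

lemma gamma_norm_triangle: "gamma_norm (u + v) \<le> gamma_norm u + gamma_norm v"
proof (rule field_le_epsilon)
  fix e :: real assume "e > 0"
  hence e: "e/2 > 0" by simp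
  obtain xs where xs: "abs_alg_tensor xs = u" "tensor_cost xs < gamma_norm u + e/2"
    by (rule gamma_norm_approx [OF e])
  obtain ys where ys: "abs_alg_tensor ys = v" "tensor_cost ys < gamma_norm v + e/2"
    by (rule gamma_norm_approx [OF e])
  have "gamma_norm (u + v) \<le> tensor_cost (xs @ ys)"
    using gamma_norm_le [of "xs @ ys"] xs(1) ys(1) by (simp add: plus_alg_tensor.abs_eq [symmetric])
  thus "gamma_norm (u + v) \<le> gamma_norm u + gamma_norm v + e"
    using xs(2) ys(2) by (simp add: tensor_cost_simps)
qed

lemma gamma_norm_scaleC: "gamma_norm (c *\<^sub>C u) = cmod c * gamma_norm u"
proof -
  have cost: "tensor_cost (map (\<lambda>(x, y). (c *\<^sub>C x, y)) xs) = cmod c * tensor_cost xs"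
    for c and xs :: "('a \<times> 'b) list"
    by (induction xs) (auto simp: tensor_cost_simps norm_scaleC algebra_simps)
  have le: "gamma_norm (c *\<^sub>C u) \<le> cmod c * gamma_norm u" if "c \<noteq> 0" for c and u :: "('a, 'b) alg_tensor"
  proof (rule field_le_epsilon)
    fix e :: real assume "e > 0"
    hence e: "e / cmod c > 0" using that by simp
    obtain xs where xs: "abs_alg_tensor xs = u" "tensor_cost xs < gamma_norm u + e / cmod c"
      by (rule gamma_norm_approx [OF e])
    have "gamma_norm (c *\<^sub>C u) \<le> cmod c * tensor_cost xs"
      using gamma_norm_le [of "map (\<lambda>(x, y). (c *\<^sub>C x, y)) xs"] xs(1)
      by (simp add: cost scaleC_alg_tensor.abs_eq [symmetric])
    also have "\<dots> \<le> cmod c * (gamma_norm u + e / cmod c)"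
      using xs(2) by (intro mult_left_mono) simp_all
    also have "\<dots> = cmod c * gamma_norm u + e"
      using that by (simp add: distrib_left)
    finally show "gamma_norm (c *\<^sub>C u) \<le> cmod c * gamma_norm u + e" .
  qed
  show ?thesis
  proof (cases "c = 0")
    case False
    have "gamma_norm u \<le> cmod (inverse c) * gamma_norm (c *\<^sub>C u)"
      using le [of "inverse c" "c *\<^sub>C u"] False by (simp add: scaleC_scaleC)
    hence "cmod c * gamma_norm u \<le> gamma_norm (c *\<^sub>C u)"
      using False by (simp add: norm_inverse norm_divide field_simps)
    with le [OF False, of u] show ?thesis by simp
  qed simp
qed

lemma gamma_norm_minus: "gamma_norm (- u) = gamma_norm u"
  using gamma_norm_scaleC [of "-1" u] by simp

lemma gamma_norm_mult:
  fixes u v :: "('a::complex_normed_algebra, 'b::complex_normed_algebra) alg_tensor"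
  shows "gamma_norm (u * v) \<le> gamma_norm u * gamma_norm v"
proof -
  have "gamma_norm (u * v) \<le> (gamma_norm u + e) * (gamma_norm v + e)" if e: "e > 0" for e
  proof -
    obtain xs where xs: "abs_alg_tensor xs = u" "tensor_cost xs < gamma_norm u + e"
      by (rule gamma_norm_approx [OF e])
    obtain ys where ys: "abs_alg_tensor ys = v" "tensor_cost ys < gamma_norm v + e"
      by (rule gamma_norm_approx [OF e])
    have "gamma_norm (u * v) \<le> tensor_cost (tensor_mult xs ys)"
      using gamma_norm_le [of "tensor_mult xs ys"] xs(1) ys(1) by (simp add: times_alg_tensor.abs_eq [symmetric])
    also have "\<dots> \<le> tensor_cost xs * tensor_cost ys"
      by (rule tensor_cost_mult)
    also have "\<dots> \<le> (gamma_norm u + e) * (gamma_norm v + e)"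
      using xs(2) ys(2) e gamma_norm_nonneg [of u] by (intro mult_mono) (simp_all add: tensor_cost_nonneg)
    finally show ?thesis .
  qed
  hence ev: "\<forall>\<^sub>F e in at_right 0. gamma_norm (u * v) \<le> (gamma_norm u + e) * (gamma_norm v + e)"
    by (simp add: eventually_at_right_less eventually_mono [OF eventually_at_right_less])
  have "((\<lambda>e. (gamma_norm u + e) * (gamma_norm v + e)) \<longlongrightarrow> (gamma_norm u + 0) * (gamma_norm v + 0)) (at_right 0)"
    by (intro tendsto_intros)
  from tendsto_lowerbound [OF this ev] show ?thesis by simp
qed

lemma gamma_norm_minus_commute: "gamma_norm (u - v) = gamma_norm (v - u)"
  using gamma_norm_minus [of "u - v"] by simp

lemma gamma_norm_triangle3: "gamma_norm (u - w) \<le> gamma_norm (u - v) + gamma_norm (v - w)"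
  using gamma_norm_triangle [of "u - v" "v - w"] by simp

lemma gamma_norm_diff_le: "\<bar>gamma_norm u - gamma_norm v\<bar> \<le> gamma_norm (u - v)"
  using gamma_norm_triangle [of "u - v" v] gamma_norm_triangle [of "v - u" u]
    gamma_norm_minus_commute [of u v] by simp

text \<open>The completion, constructed from Cauchy sequences with respect to \<^const>\<open>gamma_norm\<close> modulo
  null sequences.  It is a classical fact that \<^const>\<open>gamma_norm\<close> is a norm and not only a seminorm;
  the construction does not depend on it.\<close>

definition gamma_Cauchy ::
    "(nat \<Rightarrow> ('a::complex_normed_vector, 'b::complex_normed_vector) alg_tensor) \<Rightarrow> bool"
  where "gamma_Cauchy X \<longleftrightarrow> (\<forall>e>0. \<exists>N. \<forall>m\<ge>N. \<forall>n\<ge>N. gamma_norm (X m - X n) < e)"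

definition completion_eq ::
    "(nat \<Rightarrow> ('a::complex_normed_vector, 'b::complex_normed_vector) alg_tensor) \<Rightarrow> (nat \<Rightarrow> ('a, 'b) alg_tensor) \<Rightarrow> bool"
  where "completion_eq X Y \<longleftrightarrow>
    gamma_Cauchy X \<and> gamma_Cauchy Y \<and> (\<lambda>n. gamma_norm (X n - Y n)) \<longlonglongrightarrow> 0"

lemma gamma_null_comparison:
  assumes "\<And>n. gamma_norm (Z n) \<le> f n" "f \<longlonglongrightarrow> 0"
  shows "(\<lambda>n. gamma_norm (Z n)) \<longlonglongrightarrow> 0"
  by (rule tendsto_sandwich [OF _ _ tendsto_const assms(2)])
    (simp_all add: assms(1) gamma_norm_nonneg)

lemma gamma_Cauchy_const: "gamma_Cauchy (\<lambda>_. u)"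
  by (simp add: gamma_Cauchy_def)

lemma completion_eq_refl_iff: "completion_eq X X \<longleftrightarrow> gamma_Cauchy X"
  by (simp add: completion_eq_def)

quotient_type (overloaded) ('a, 'b) proj_tensor =
  "nat \<Rightarrow> ('a::complex_normed_algebra, 'b::complex_normed_algebra) alg_tensor" / partial: completion_eq
proof (rule part_equivpI)
  show "\<exists>X :: nat \<Rightarrow> ('a, 'b) alg_tensor. completion_eq X X"
    using gamma_Cauchy_const completion_eq_refl_iff by blast
  show "symp (completion_eq :: (nat \<Rightarrow> ('a, 'b) alg_tensor) \<Rightarrow> _)"
    by (rule sympI) (simp add: completion_eq_def gamma_norm_minus_commute)
  show "transp (completion_eq :: (nat \<Rightarrow> ('a, 'b) alg_tensor) \<Rightarrow> _)"
  proof (rule transpI)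
    fix X Y Z :: "nat \<Rightarrow> ('a, 'b) alg_tensor"
    assume a: "completion_eq X Y" "completion_eq Y Z"
    have "(\<lambda>n. gamma_norm (X n - Y n) + gamma_norm (Y n - Z n)) \<longlonglongrightarrow> 0 + 0"
      using a unfolding completion_eq_def by (intro tendsto_add) simp_all
    hence "(\<lambda>n. gamma_norm (X n - Z n)) \<longlonglongrightarrow> 0"
      by (intro gamma_null_comparison [OF gamma_norm_triangle3]) simp
    with a show "completion_eq X Z" by (simp add: completion_eq_def)
  qed
qed

lemma gamma_Cauchy_Cauchy:
  assumes "gamma_Cauchy X"
  shows "Cauchy (\<lambda>n. gamma_norm (X n))"
proof (rule CauchyI)
  fix e :: real assume "e > 0"
  then obtain N where "\<forall>m\<ge>N. \<forall>n\<ge>N. gamma_norm (X m - X n) < e"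
    using assms unfolding gamma_Cauchy_def by blast
  thus "\<exists>N. \<forall>m\<ge>N. \<forall>n\<ge>N. norm (gamma_norm (X m) - gamma_norm (X n)) < e"
    using gamma_norm_diff_le unfolding real_norm_def by (meson le_less_trans)
qed

lemma gamma_Cauchy_tendsto:
  assumes "gamma_Cauchy X"
  shows "(\<lambda>n. gamma_norm (X n)) \<longlonglongrightarrow> lim (\<lambda>n. gamma_norm (X n))"
  using gamma_Cauchy_Cauchy [OF assms] by (simp add: Cauchy_convergent_iff convergent_LIMSEQ_iff)

lemma gamma_Cauchy_bounded:
  assumes "gamma_Cauchy X"
  obtains K where "K > 0" "\<And>n. gamma_norm (X n) \<le> K"
proof -
  obtain K where "K > 0" "\<And>n. norm (gamma_norm (X n)) \<le> K"
    using Cauchy_Bseq [OF gamma_Cauchy_Cauchy [OF assms]] unfolding Bseq_def by blast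
  thus ?thesis using that by (auto simp: abs_le_iff)
qed

lemma gamma_Cauchy_add:
  assumes "gamma_Cauchy X" "gamma_Cauchy Y"
  shows "gamma_Cauchy (\<lambda>n. X n + Y n)"
  unfolding gamma_Cauchy_def
proof (intro allI impI)
  fix e :: real assume "e > 0"
  hence e: "e/2 > 0" by simp
  obtain N where N: "\<And>m n. m \<ge> N \<Longrightarrow> n \<ge> N \<Longrightarrow> gamma_norm (X m - X n) < e/2"
    using assms(1) e unfolding gamma_Cauchy_def by blast
  obtain M where M: "\<And>m n. m \<ge> M \<Longrightarrow> n \<ge> M \<Longrightarrow> gamma_norm (Y m - Y n) < e/2"
    using assms(2) e unfolding gamma_Cauchy_def by blast
  have "gamma_norm (X m + Y m - (X n + Y n)) < e" if "m \<ge> max N M" "n \<ge> max N M" for m n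
    using gamma_norm_triangle [of "X m - X n" "Y m - Y n"] N [of m n] M [of m n] that
    by (simp add: algebra_simps)
  thus "\<exists>N. \<forall>m\<ge>N. \<forall>n\<ge>N. gamma_norm (X m + Y m - (X n + Y n)) < e" by blast
qed

lemma gamma_Cauchy_scaleC:
  assumes "gamma_Cauchy X"
  shows "gamma_Cauchy (\<lambda>n. c *\<^sub>C X n)"
  unfolding gamma_Cauchy_def
proof (intro allI impI)
  fix e :: real assume "e > 0"
  hence e: "e / (cmod c + 1) > 0" by (simp add: add_nonneg_pos)
  obtain N where N: "\<And>m n. m \<ge> N \<Longrightarrow> n \<ge> N \<Longrightarrow> gamma_norm (X m - X n) < e / (cmod c + 1)"
    using assms e unfolding gamma_Cauchy_def by blast
  have "gamma_norm (c *\<^sub>C X m - c *\<^sub>C X n) < e" if "m \<ge> N" "n \<ge> N" for m n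
  proof -
    have "gamma_norm (c *\<^sub>C X m - c *\<^sub>C X n) = cmod c * gamma_norm (X m - X n)"
      by (simp add: complex_vector.scale_right_diff_distrib [symmetric] gamma_norm_scaleC)
    also have "\<dots> \<le> (cmod c + 1) * gamma_norm (X m - X n)"
      by (simp add: mult_right_mono gamma_norm_nonneg)
    also have "\<dots> < e"
      using N [OF that] by (simp add: pos_less_divide_eq add_nonneg_pos mult.commute)
    finally show ?thesis .
  qed
  thus "\<exists>N. \<forall>m\<ge>N. \<forall>n\<ge>N. gamma_norm (c *\<^sub>C X m - c *\<^sub>C X n) < e" by blast
qed

lemma gamma_norm_mult_diff:
  fixes u u' v v' :: "('a::complex_normed_algebra, 'b::complex_normed_algebra) alg_tensor"
  shows "gamma_norm (u * v - u' * v')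
    \<le> gamma_norm u * gamma_norm (v - v') + gamma_norm (u - u') * gamma_norm v'"
proof -
  have "u * v - u' * v' = u * (v - v') + (u - u') * v'"
    by (simp add: algebra_simps)
  thus ?thesis
    using gamma_norm_triangle [of "u * (v - v')" "(u - u') * v'"]
      gamma_norm_mult [of u "v - v'"] gamma_norm_mult [of "u - u'" v'] by simp
qed

lemma gamma_Cauchy_mult:
  fixes X Y :: "nat \<Rightarrow> ('a::complex_normed_algebra, 'b::complex_normed_algebra) alg_tensor"
  assumes "gamma_Cauchy X" "gamma_Cauchy Y"
  shows "gamma_Cauchy (\<lambda>n. X n * Y n)"
  unfolding gamma_Cauchy_def
proof (intro allI impI)
  fix e :: real assume "e > 0"
  obtain K where K: "K > 0" "\<And>n. gamma_norm (X n) \<le> K"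
    using gamma_Cauchy_bounded [OF assms(1)] by blast
  obtain L where L: "L > 0" "\<And>n. gamma_norm (Y n) \<le> L"
    using gamma_Cauchy_bounded [OF assms(2)] by blast
  have eL: "e / (2 * L) > 0" and eK: "e / (2 * K) > 0" using K L \<open>e > 0\<close> by simp_all
  obtain N where N: "\<And>m n. m \<ge> N \<Longrightarrow> n \<ge> N \<Longrightarrow> gamma_norm (X m - X n) < e / (2 * L)"
    using assms(1) eL unfolding gamma_Cauchy_def by blast
  obtain M where M: "\<And>m n. m \<ge> M \<Longrightarrow> n \<ge> M \<Longrightarrow> gamma_norm (Y m - Y n) < e / (2 * K)"
    using assms(2) eK unfolding gamma_Cauchy_def by blast
  have "gamma_norm (X m * Y m - X n * Y n) < e" if "m \<ge> max N M" "n \<ge> max N M" for m n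
  proof -
    have "gamma_norm (X m) * gamma_norm (Y m - Y n) \<le> K * gamma_norm (Y m - Y n)"
      by (rule mult_right_mono [OF K(2) gamma_norm_nonneg])
    also have "\<dots> < K * (e / (2 * K))"
      using M [of m n] that K by (intro mult_strict_left_mono) simp_all
    finally have 1: "gamma_norm (X m) * gamma_norm (Y m - Y n) < e/2" using K by simp
    have "gamma_norm (X m - X n) * gamma_norm (Y n) \<le> gamma_norm (X m - X n) * L"
      by (rule mult_left_mono [OF L(2) gamma_norm_nonneg])
    also have "\<dots> < e / (2 * L) * L"
      using N [of m n] that L by (intro mult_strict_right_mono) simp_all
    finally have 2: "gamma_norm (X m - X n) * gamma_norm (Y n) < e/2" using L by simp
    show ?thesis
      using gamma_norm_mult_diff [of "X m" "Y m" "X n" "Y n"] 1 2 by simp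
  qed
  thus "\<exists>N. \<forall>m\<ge>N. \<forall>n\<ge>N. gamma_norm (X m * Y m - X n * Y n) < e" by blast
qed

lemma completion_eq_add:
  assumes "completion_eq X X'" "completion_eq Y Y'"
  shows "completion_eq (\<lambda>n. X n + Y n) (\<lambda>n. X' n + Y' n)"
proof -
  have "(\<lambda>n. gamma_norm (X n - X' n) + gamma_norm (Y n - Y' n)) \<longlonglongrightarrow> 0 + 0"
    using assms unfolding completion_eq_def by (intro tendsto_add) simp_all
  moreover have "gamma_norm (X n + Y n - (X' n + Y' n)) \<le> gamma_norm (X n - X' n) + gamma_norm (Y n - Y' n)" for n
    using gamma_norm_triangle [of "X n - X' n" "Y n - Y' n"] by (simp add: algebra_simps)
  ultimately have "(\<lambda>n. gamma_norm (X n + Y n - (X' n + Y' n))) \<longlonglongrightarrow> 0"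
    by (intro gamma_null_comparison) simp_all
  with assms show ?thesis by (simp add: completion_eq_def gamma_Cauchy_add)
qed

lemma completion_eq_scaleC:
  assumes "completion_eq X X'"
  shows "completion_eq (\<lambda>n. c *\<^sub>C X n) (\<lambda>n. c *\<^sub>C X' n)"
proof -
  have "(\<lambda>n. cmod c * gamma_norm (X n - X' n)) \<longlonglongrightarrow> cmod c * 0"
    using assms unfolding completion_eq_def by (intro tendsto_mult tendsto_const) simp_all
  hence "(\<lambda>n. gamma_norm (c *\<^sub>C X n - c *\<^sub>C X' n)) \<longlonglongrightarrow> 0"
    by (simp add: complex_vector.scale_right_diff_distrib [symmetric] gamma_norm_scaleC)
  with assms show ?thesis by (simp add: completion_eq_def gamma_Cauchy_scaleC)
qed

lemma completion_eq_mult: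
  fixes X Y :: "nat \<Rightarrow> ('a::complex_normed_algebra, 'b::complex_normed_algebra) alg_tensor"
  assumes "completion_eq X X'" "completion_eq Y Y'"
  shows "completion_eq (\<lambda>n. X n * Y n) (\<lambda>n. X' n * Y' n)"
proof -
  have "(\<lambda>n. gamma_norm (X n) * gamma_norm (Y n - Y' n) + gamma_norm (X n - X' n) * gamma_norm (Y' n))
      \<longlonglongrightarrow> lim (\<lambda>n. gamma_norm (X n)) * 0 + 0 * lim (\<lambda>n. gamma_norm (Y' n))"
    using assms unfolding completion_eq_def
    by (intro tendsto_add tendsto_mult gamma_Cauchy_tendsto) simp_all
  hence "(\<lambda>n. gamma_norm (X n * Y n - X' n * Y' n)) \<longlonglongrightarrow> 0"
    by (intro gamma_null_comparison [OF gamma_norm_mult_diff]) simp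
  with assms show ?thesis by (simp add: completion_eq_def gamma_Cauchy_mult)
qed

lemma completion_eq_norm:
  assumes "completion_eq X Y"
  shows "lim (\<lambda>n. gamma_norm (X n)) = lim (\<lambda>n. gamma_norm (Y n))"
proof -
  have "(\<lambda>n. gamma_norm (X n) - gamma_norm (Y n)) \<longlonglongrightarrow> 0"
    by (rule Lim_null_comparison [of _ "\<lambda>n. gamma_norm (X n - Y n)"])
      (use assms in \<open>simp_all add: completion_eq_def gamma_norm_diff_le\<close>)
  moreover have "(\<lambda>n. gamma_norm (X n) - gamma_norm (Y n))
      \<longlonglongrightarrow> lim (\<lambda>n. gamma_norm (X n)) - lim (\<lambda>n. gamma_norm (Y n))"
    using assms unfolding completion_eq_def by (intro tendsto_diff gamma_Cauchy_tendsto) simp_all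
  ultimately show ?thesis
    using LIMSEQ_unique by fastforce
qed

instantiation proj_tensor :: (complex_normed_algebra, complex_normed_algebra) complex_normed_algebra
begin

lift_definition zero_proj_tensor :: "('a, 'b) proj_tensor" is "\<lambda>_. 0"
  by (simp add: completion_eq_refl_iff gamma_Cauchy_const)

lift_definition plus_proj_tensor :: "('a, 'b) proj_tensor \<Rightarrow> ('a, 'b) proj_tensor \<Rightarrow> ('a, 'b) proj_tensor"
  is "\<lambda>X Y n. X n + Y n"
  by (rule completion_eq_add)

lift_definition scaleC_proj_tensor :: "complex \<Rightarrow> ('a, 'b) proj_tensor \<Rightarrow> ('a, 'b) proj_tensor"
  is "\<lambda>c X n. c *\<^sub>C X n"
  by (rule completion_eq_scaleC)

lift_definition times_proj_tensor :: "('a, 'b) proj_tensor \<Rightarrow> ('a, 'b) proj_tensor \<Rightarrow> ('a, 'b) proj_tensor"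
  is "\<lambda>X Y n. X n * Y n"
  by (rule completion_eq_mult)

lift_definition norm_proj_tensor :: "('a, 'b) proj_tensor \<Rightarrow> real"
  is "\<lambda>X. lim (\<lambda>n. gamma_norm (X n))"
  by (rule completion_eq_norm)

definition scaleR_proj_tensor :: "real \<Rightarrow> ('a, 'b) proj_tensor \<Rightarrow> ('a, 'b) proj_tensor"
  where "scaleR_proj_tensor r P = complex_of_real r *\<^sub>C P"

definition uminus_proj_tensor :: "('a, 'b) proj_tensor \<Rightarrow> ('a, 'b) proj_tensor"
  where "uminus_proj_tensor P = (-1) *\<^sub>C P"

definition minus_proj_tensor :: "('a, 'b) proj_tensor \<Rightarrow> ('a, 'b) proj_tensor \<Rightarrow> ('a, 'b) proj_tensor"
  where "minus_proj_tensor P Q = P + - Q"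

definition dist_proj_tensor :: "('a, 'b) proj_tensor \<Rightarrow> ('a, 'b) proj_tensor \<Rightarrow> real"
  where "dist_proj_tensor P Q = norm (P - Q)"

definition sgn_proj_tensor :: "('a, 'b) proj_tensor \<Rightarrow> ('a, 'b) proj_tensor"
  where "sgn_proj_tensor P = scaleR (inverse (norm P)) P"

definition uniformity_proj_tensor :: "(('a, 'b) proj_tensor \<times> ('a, 'b) proj_tensor) filter"
  where "uniformity_proj_tensor = (INF e\<in>{0 <..}. principal {(x, y). dist x y < e})"

definition open_proj_tensor :: "('a, 'b) proj_tensor set \<Rightarrow> bool"
  where "open_proj_tensor U = (\<forall>x\<in>U. \<forall>\<^sub>F (x', y) in uniformity. x' = x \<longrightarrow> y \<in> U)"

lemma proj_tensor_rep:
  obtains X where "gamma_Cauchy X" "P = abs_proj_tensor X"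
  by (metis completion_eq_refl_iff Quotient_proj_tensor Quotient_abs_rep Quotient_rep_reflp)

lemma abs_proj_tensor_simps:
  "gamma_Cauchy X \<Longrightarrow> gamma_Cauchy Y \<Longrightarrow>
    abs_proj_tensor X + abs_proj_tensor Y = abs_proj_tensor (\<lambda>n. X n + Y n)"
  "gamma_Cauchy X \<Longrightarrow> gamma_Cauchy Y \<Longrightarrow>
    abs_proj_tensor X * abs_proj_tensor Y = abs_proj_tensor (\<lambda>n. X n * Y n)"
  "gamma_Cauchy X \<Longrightarrow> c *\<^sub>C abs_proj_tensor X = abs_proj_tensor (\<lambda>n. c *\<^sub>C X n)"
  by (simp_all add: completion_eq_refl_iff plus_proj_tensor.abs_eq times_proj_tensor.abs_eq
      scaleC_proj_tensor.abs_eq)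

lemma abs_proj_tensor_norm:
  assumes "gamma_Cauchy X"
  shows "(\<lambda>n. gamma_norm (X n)) \<longlonglongrightarrow> norm (abs_proj_tensor X)"
  using gamma_Cauchy_tendsto [OF assms] assms
  by (simp add: completion_eq_refl_iff norm_proj_tensor.abs_eq)

lemma abs_proj_tensor_eq_iff:
  assumes "gamma_Cauchy X" "gamma_Cauchy Y"
  shows "abs_proj_tensor X = abs_proj_tensor Y \<longleftrightarrow> (\<lambda>n. gamma_norm (X n - Y n)) \<longlonglongrightarrow> 0"
  using Quotient_rel [OF Quotient_proj_tensor, of X Y] assms
  by (simp add: completion_eq_def)

instance
proof
  fix P Q R :: "('a, 'b) proj_tensor" and a b :: complex and r q :: real
  obtain X where X: "gamma_Cauchy X" "P = abs_proj_tensor X" by (rule proj_tensor_rep)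
  obtain Y where Y: "gamma_Cauchy Y" "Q = abs_proj_tensor Y" by (rule proj_tensor_rep)
  obtain Z where Z: "gamma_Cauchy Z" "R = abs_proj_tensor Z" by (rule proj_tensor_rep)
  note C = X(1) Y(1) Z(1) gamma_Cauchy_add gamma_Cauchy_mult gamma_Cauchy_scaleC gamma_Cauchy_const
  note S = X(2) Y(2) Z(2) abs_proj_tensor_simps C
  show "P + Q + R = P + (Q + R)" by (simp add: S add.assoc)
  show "P + Q = Q + P" by (simp add: S add.commute)
  show "0 + P = P" by (simp add: S zero_proj_tensor_def)
  show ar: "a *\<^sub>C (P + Q) = a *\<^sub>C P + a *\<^sub>C Q" for a by (simp add: S scaleC_add_right)
  show al: "(a + b) *\<^sub>C P = a *\<^sub>C P + b *\<^sub>C P" for a b by (simp add: S scaleC_add_left)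
  show ss: "a *\<^sub>C (b *\<^sub>C P) = (a * b) *\<^sub>C P" for a b by (simp add: S scaleC_scaleC)
  have one: "1 *\<^sub>C P = P" by (simp add: S)
  have "0 *\<^sub>C P = 0" by (simp add: S zero_proj_tensor_def)
  thus "- P + P = 0"
    using al [of "-1" 1] by (simp add: uminus_proj_tensor_def one)
  show "P - Q = P + - Q" by (rule minus_proj_tensor_def)
  show "r *\<^sub>R P = complex_of_real r *\<^sub>C P" by (rule scaleR_proj_tensor_def)
  show "r *\<^sub>R (P + Q) = r *\<^sub>R P + r *\<^sub>R Q" by (simp add: scaleR_proj_tensor_def ar)
  show "(r + q) *\<^sub>R P = r *\<^sub>R P + q *\<^sub>R P" by (simp add: scaleR_proj_tensor_def al)
  show "r *\<^sub>R (q *\<^sub>R P) = (r * q) *\<^sub>R P" by (simp add: scaleR_proj_tensor_def ss)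
  show "1 *\<^sub>R P = P" by (simp add: scaleR_proj_tensor_def one)
  show "P * Q * R = P * (Q * R)" by (simp add: S mult.assoc)
  show "(P + Q) * R = P * R + Q * R" by (simp add: S distrib_right)
  show "P * (Q + R) = P * Q + P * R" by (simp add: S distrib_left)
  show ml: "a *\<^sub>C P * Q = a *\<^sub>C (P * Q)" for a by (simp add: S alg_tensor_mult_scaleC)
  show mr: "P * a *\<^sub>C Q = a *\<^sub>C (P * Q)" for a by (simp add: S alg_tensor_mult_scaleC)
  show "r *\<^sub>R P * Q = r *\<^sub>R (P * Q)" by (simp add: scaleR_proj_tensor_def ml)
  show "P * r *\<^sub>R Q = r *\<^sub>R (P * Q)" by (simp add: scaleR_proj_tensor_def mr)
  show "dist P Q = norm (P - Q)" by (rule dist_proj_tensor_def)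
  show "sgn P = scaleR (inverse (norm P)) P" by (rule sgn_proj_tensor_def)
  show "(uniformity :: (('a, 'b) proj_tensor \<times> ('a, 'b) proj_tensor) filter)
      = (INF e\<in>{0 <..}. principal {(x, y). dist x y < e})"
    by (rule uniformity_proj_tensor_def)
  show "open U = (\<forall>x\<in>U. \<forall>\<^sub>F (x', y) in uniformity. x' = x \<longrightarrow> y \<in> U)"
    for U :: "('a, 'b) proj_tensor set"
    by (rule open_proj_tensor_def)
  note nX = abs_proj_tensor_norm [OF X(1), folded X(2)]
  note nY = abs_proj_tensor_norm [OF Y(1), folded Y(2)]
  have "norm P = 0 \<longleftrightarrow> (\<lambda>n. gamma_norm (X n)) \<longlonglongrightarrow> 0"
    using nX LIMSEQ_unique by metis
  thus "norm P = 0 \<longleftrightarrow> P = 0"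
    using abs_proj_tensor_eq_iff [OF X(1) gamma_Cauchy_const [of 0]]
    by (simp add: X(2) zero_proj_tensor_def)
  have "(\<lambda>n. gamma_norm (X n + Y n)) \<longlonglongrightarrow> norm (P + Q)"
    using abs_proj_tensor_norm [of "\<lambda>n. X n + Y n"] by (simp add: S)
  thus "norm (P + Q) \<le> norm P + norm Q"
    using tendsto_add [OF nX nY] by (rule LIMSEQ_le) (simp add: gamma_norm_triangle)
  have "(\<lambda>n. gamma_norm (X n * Y n)) \<longlonglongrightarrow> norm (P * Q)"
    using abs_proj_tensor_norm [of "\<lambda>n. X n * Y n"] by (simp add: S)
  thus "norm (P * Q) \<le> norm P * norm Q"
    using tendsto_mult [OF nX nY] by (rule LIMSEQ_le) (simp add: gamma_norm_mult)
  show nC: "norm (a *\<^sub>C P) = cmod a * norm P" for a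
  proof (rule LIMSEQ_unique)
    show "(\<lambda>n. gamma_norm (a *\<^sub>C X n)) \<longlonglongrightarrow> norm (a *\<^sub>C P)"
      using abs_proj_tensor_norm [of "\<lambda>n. a *\<^sub>C X n"] by (simp add: S)
    show "(\<lambda>n. gamma_norm (a *\<^sub>C X n)) \<longlonglongrightarrow> cmod a * norm P"
      unfolding gamma_norm_scaleC by (intro tendsto_mult tendsto_const nX)
  qed
  show "norm (r *\<^sub>R P) = \<bar>r\<bar> * norm P" by (simp add: scaleR_proj_tensor_def nC)
qed

end

text \<open>The canonical map of the algebraic tensor product into its completion.  The lemmas below show
  that it is multiplicative, transports \<^const>\<open>gamma_norm\<close> to the norm and has dense range, and
  that the completion is complete.\<close>

definition proj_embed ::
    "('a::complex_normed_algebra, 'b::complex_normed_algebra) alg_tensor \<Rightarrow> ('a, 'b) proj_tensor"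
  where "proj_embed u = abs_proj_tensor (\<lambda>_. u)"

lemma proj_embed_simps:
  "proj_embed (u + v) = proj_embed u + proj_embed v"
  "proj_embed (c *\<^sub>C u) = c *\<^sub>C proj_embed u"
  "proj_embed (u * v) = proj_embed u * proj_embed v"
  by (simp_all add: proj_embed_def abs_proj_tensor_simps gamma_Cauchy_const)

lemma norm_proj_embed: "norm (proj_embed u) = gamma_norm u"
  using LIMSEQ_unique [OF abs_proj_tensor_norm [OF gamma_Cauchy_const] tendsto_const]
  by (simp add: proj_embed_def)

lemma proj_embed_diff: "proj_embed (u - v) = proj_embed u - proj_embed v"
  using proj_embed_simps(1) [of u "(-1) *\<^sub>C v"] proj_embed_simps(2) [of "-1" v] by simp

lemma proj_embed_tendsto:
  assumes X: "gamma_Cauchy X"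
  shows "(\<lambda>n. proj_embed (X n)) \<longlonglongrightarrow> abs_proj_tensor X"
proof (rule LIMSEQ_I)
  fix e :: real assume "e > 0"
  hence "e/2 > 0" by simp
  then obtain N where N: "\<And>m n. m \<ge> N \<Longrightarrow> n \<ge> N \<Longrightarrow> gamma_norm (X m - X n) < e/2"
    using X unfolding gamma_Cauchy_def by blast
  have "norm (proj_embed (X n) - abs_proj_tensor X) < e" if n: "n \<ge> N" for n
  proof -
    have C: "gamma_Cauchy (\<lambda>m. X m + (-1) *\<^sub>C X n)"
      by (intro gamma_Cauchy_add X gamma_Cauchy_const)
    have "abs_proj_tensor (\<lambda>m. X m + (-1) *\<^sub>C X n) = abs_proj_tensor X + (-1) *\<^sub>C proj_embed (X n)"
      unfolding proj_embed_def abs_proj_tensor_simps(3) [OF gamma_Cauchy_const]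
      by (rule abs_proj_tensor_simps(1) [OF X gamma_Cauchy_const, symmetric])
    hence "(\<lambda>m. gamma_norm (X m - X n)) \<longlonglongrightarrow> norm (abs_proj_tensor X - proj_embed (X n))"
      using abs_proj_tensor_norm [OF C] by simp
    moreover have "\<forall>\<^sub>F m in sequentially. gamma_norm (X m - X n) \<le> e/2"
      unfolding eventually_sequentially using less_imp_le [OF N [OF _ n]] by blast
    ultimately have "norm (abs_proj_tensor X - proj_embed (X n)) \<le> e/2"
      by (rule tendsto_upperbound) simp
    thus ?thesis using \<open>e > 0\<close> by (simp add: norm_minus_commute)
  qed
  thus "\<exists>N. \<forall>n\<ge>N. norm (proj_embed (X n) - abs_proj_tensor X) < e" by blast
qed

lemma proj_embed_dense: "closure (range proj_embed) = UNIV"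
proof -
  have "P \<in> closure (range proj_embed)" for P :: "('a, 'b) proj_tensor"
  proof -
    obtain X where X: "gamma_Cauchy X" "P = abs_proj_tensor X" by (rule proj_tensor_rep)
    show ?thesis
      unfolding closure_sequential
      by (rule exI [of _ "\<lambda>n. proj_embed (X n)"]) (simp add: X(2) proj_embed_tendsto [OF X(1)])
  qed
  thus ?thesis by blast
qed

instance proj_tensor :: (complex_normed_algebra, complex_normed_algebra) complex_banach_algebra
proof
  fix P :: "nat \<Rightarrow> ('a, 'b) proj_tensor" assume P: "Cauchy P"
  have "\<exists>u. norm (proj_embed u - P n) < inverse (real (Suc n))" for n
  proof -
    have "P n \<in> closure (range proj_embed)" by (simp add: proj_embed_dense)
    thus ?thesis
      unfolding closure_approachable dist_norm by (metis (no_types) imageE inverse_positive_iff_positive of_nat_0_less_iff zero_less_Suc)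
  qed
  then obtain u where u: "\<And>n. norm (proj_embed (u n) - P n) < inverse (real (Suc n))"
    by metis
  have d0: "(\<lambda>n. proj_embed (u n) - P n) \<longlonglongrightarrow> 0"
    by (rule Lim_null_comparison [OF _ LIMSEQ_inverse_real_of_nat])
      (rule always_eventually, rule allI, rule less_imp_le, rule u)
  have "Cauchy (\<lambda>n. proj_embed (u n))"
  proof (rule CauchyI)
    fix e :: real assume "e > 0"
    hence e: "e/3 > 0" by simp
    obtain N where N: "\<And>m n. m \<ge> N \<Longrightarrow> n \<ge> N \<Longrightarrow> norm (P m - P n) < e/3"
      using CauchyD [OF P e] by blast
    obtain M where M: "\<And>n. n \<ge> M \<Longrightarrow> norm (proj_embed (u n) - P n) < e/3"
      using LIMSEQ_D [OF d0 e] by auto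
    have "norm (proj_embed (u m) - proj_embed (u n)) < e" if "m \<ge> max N M" "n \<ge> max N M" for m n
    proof -
      have eq: "proj_embed (u m) - proj_embed (u n)
          = (proj_embed (u m) - P m) + (P m - P n) - (proj_embed (u n) - P n)"
        by simp
      have "norm (proj_embed (u m) - proj_embed (u n))
          \<le> norm (proj_embed (u m) - P m) + norm (P m - P n) + norm (proj_embed (u n) - P n)"
        unfolding eq by (rule order_trans [OF norm_triangle_ineq4 add_right_mono [OF norm_triangle_ineq]])
      thus ?thesis
        using N [of m n] M [of m] M [of n] that by simp
    qed
    thus "\<exists>K. \<forall>m\<ge>K. \<forall>n\<ge>K. norm (proj_embed (u m) - proj_embed (u n)) < e" by blast
  qed
  hence "gamma_Cauchy u"
    unfolding Cauchy_def gamma_Cauchy_def dist_norm proj_embed_diff [symmetric] norm_proj_embed .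
  hence "(\<lambda>n. proj_embed (u n)) \<longlonglongrightarrow> abs_proj_tensor u"
    by (rule proj_embed_tendsto)
  from tendsto_diff [OF this d0] have "P \<longlonglongrightarrow> abs_proj_tensor u" by simp
  thus "convergent P" unfolding convergent_def by blast
qed

end

(* A bounded bilinear form \<omega> on two algebras A and B is a functional on their projective tensor
   product.  If (a i) and (b j) are bounded sequences such that \<omega> (a i * b j) is 1 for i \<le> j and 0
   otherwise, then the two iterated limits differ, and weak-* cluster points of (a i) and (b j)
   in the bidual have different Arens products at \<omega>.  For Hilbert-Schmidt operators let e i j and
   f i j be the matrix units of orthonormal sequences of the two Hilbert spaces.  Put
   a i = e i 0 \<otimes> f i 0 and b j = e 0 j \<otimes> f 0 j, so that a i * b j = e i j \<otimes> f i j.  The form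
   \<omega> (S \<otimes> T) = (\<Sum>i\<le>j. S i j * T i j) on the matrix entries is bounded by Cauchy-Schwarz. *)
theory Submission
  imports Defs
begin

section \<open>Arens regularity and iterated limits\<close>

text \<open>Banach-Alaoglu by Tychonoff: the evaluations at \<open>a n\<close> lie in a compact
  product of discs. A cluster point is a pointwise limit along a filter finer than the sequence, so
  it inherits linearity and the bound, and it must take the value \<open>L\<close> wherever the
  evaluations converge to \<open>L\<close>. One \<open>f\<close> thus serves all functionals at
  once.\<close>

lemma ex_bidual_cluster_point:
  fixes a :: "nat \<Rightarrow> 'a::complex_normed_vector"
  assumes K: "\<And>n. norm (a n) \<le> K"
  shows "\<exists>f :: 'a cdual cdual. \<forall>\<phi> L. (\<lambda>n. cdual_apply \<phi> (a n)) \<longlonglongrightarrow> L \<longrightarrow> cdual_apply f \<phi> = L"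
proof -
  define ev where "ev n = (\<lambda>\<phi>. cdual_apply \<phi> (a n))" for n
  define F where "F = filtermap ev sequentially"
  define U :: "('a cdual \<Rightarrow> complex) set" where "U = Pi\<^sub>E UNIV (\<lambda>\<phi>. cball 0 (K * norm \<phi>))"
  have "compactin (product_topology (\<lambda>_. euclidean) UNIV) U"
    unfolding U_def compactin_PiE by (simp add: compactin_euclidean_iff)
  hence U: "compact U"
    by (simp add: euclidean_product_topology compactin_euclidean_iff)
  have "ev n \<in> U" for n
    using order_trans [OF cdual_apply_le mult_left_mono [OF K norm_ge_zero]]
    by (simp add: U_def ev_def PiE_iff mult.commute)
  hence "eventually (\<lambda>g. g \<in> U) F"
    by (simp add: F_def eventually_filtermap)
  moreover have "F \<noteq> bot"
    by (simp add: F_def filtermap_bot_iff)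
  ultimately obtain x where x: "x \<in> U" and nb: "inf (nhds x) F \<noteq> bot"
    using U unfolding compact_filter by blast
  \<comment> \<open>Along \<open>?G\<close> every coordinate converges to that of \<open>x\<close>,
    while whatever holds at all evaluations holds eventually.\<close>
  let ?G = "inf (nhds x) F"
  have xle: "cmod (x \<phi>) \<le> K * norm \<phi>" for \<phi>
    using x by (auto simp: U_def PiE_iff)
  have "((\<lambda>g. g \<phi>) \<longlongrightarrow> x \<phi>) (at x)" for \<phi>
    using continuous_on_product_coordinates [unfolded continuous_on_def]
    by (rule bspec) (rule UNIV_I)
  hence "((\<lambda>g. g \<phi>) \<longlongrightarrow> x \<phi>) (nhds x)" for \<phi>
    by (rule tendsto_at_iff_tendsto_nhds [THEN iffD1])
  hence co: "((\<lambda>g. g \<phi>) \<longlongrightarrow> x \<phi>) ?G" for \<phi>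
    by (rule tendsto_mono [rotated]) simp
  have ev: "eventually P ?G" if "\<And>n. P (ev n)" for P
  proof -
    have "eventually P F" using that by (simp add: F_def eventually_filtermap)
    thus ?thesis by (rule filter_leD [rotated]) simp
  qed
  \<comment> \<open>A general \<open>g\<close> in the product is not linear, but each
    \<open>ev n\<close> is; the two expressions therefore agree eventually along \<open>?G\<close>
    and have the same limit.\<close>
  have add: "x (\<phi> + \<psi>) = x \<phi> + x \<psi>" for \<phi> \<psi>
  proof (rule tendsto_unique [OF nb])
    show "((\<lambda>g. g \<phi> + g \<psi>) \<longlongrightarrow> x \<phi> + x \<psi>) ?G"
      by (intro tendsto_add co)
    show "((\<lambda>g. g \<phi> + g \<psi>) \<longlongrightarrow> x (\<phi> + \<psi>)) ?G"
      by (rule Lim_transform_eventually [OF co ev]) (simp add: ev_def cdual_apply_simps)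
  qed
  have scale: "x (c *\<^sub>C \<phi>) = c * x \<phi>" for c \<phi>
  proof (rule tendsto_unique [OF nb])
    show "((\<lambda>g. c * g \<phi>) \<longlongrightarrow> c * x \<phi>) ?G"
      by (intro tendsto_mult tendsto_const co)
    show "((\<lambda>g. c * g \<phi>) \<longlongrightarrow> x (c *\<^sub>C \<phi>)) ?G"
      by (rule Lim_transform_eventually [OF co ev]) (simp add: ev_def cdual_apply_simps)
  qed
  have "bounded_clinear x"
    by (rule bounded_clinear_functionalI [OF add scale xle])
  hence fx: "cdual_apply (Abs_cdual x) = x"
    by (simp add: Abs_cdual_inverse)
  have "x \<phi> = L" if "(\<lambda>n. cdual_apply \<phi> (a n)) \<longlonglongrightarrow> L" for \<phi> L
  proof (rule tendsto_unique [OF nb co])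
    have "((\<lambda>g. g \<phi>) \<longlongrightarrow> L) F"
      using that by (simp add: F_def filterlim_filtermap ev_def)
    thus "((\<lambda>g. g \<phi>) \<longlongrightarrow> L) ?G"
      by (rule tendsto_mono [rotated]) simp
  qed
  thus ?thesis
    by (intro exI [of _ "Abs_cdual x"]) (simp add: fx)
qed

text \<open>For cluster points \<open>f\<close> of \<open>a\<close> and \<open>g\<close> of
  \<open>b\<close>, the box product at \<open>\<omega>\<close> takes the limit in \<open>j\<close>
  first and then in \<open>i\<close>, giving \<open>R\<close>; the diamond product takes them in the
  other order, giving \<open>C\<close>.\<close>

lemma not_arens_regularI:
  fixes a b :: "nat \<Rightarrow> 'a::complex_normed_algebra"
  assumes a: "\<And>n. norm (a n) \<le> K" and b: "\<And>n. norm (b n) \<le> M"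
    and row: "\<And>i. (\<lambda>j. cdual_apply \<omega> (a i * b j)) \<longlonglongrightarrow> r i" and r: "r \<longlonglongrightarrow> R"
    and col: "\<And>j. (\<lambda>i. cdual_apply \<omega> (a i * b j)) \<longlonglongrightarrow> c j" and c: "c \<longlonglongrightarrow> C"
    and "R \<noteq> C"
  shows "\<not> arens_regular TYPE('a)"
proof -
  obtain f :: "'a cdual cdual"
    where f: "\<And>\<phi> L. (\<lambda>n. cdual_apply \<phi> (a n)) \<longlonglongrightarrow> L \<Longrightarrow> cdual_apply f \<phi> = L"
    using ex_bidual_cluster_point [of a K] a by blast
  obtain g :: "'a cdual cdual"
    where g: "\<And>\<phi> L. (\<lambda>n. cdual_apply \<phi> (b n)) \<longlonglongrightarrow> L \<Longrightarrow> cdual_apply g \<phi> = L"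
    using ex_bidual_cluster_point [of b M] b by blast
  have "cdual_apply (bidual_rmult \<omega> g) (a i) = r i" for i
    unfolding bidual_rmult_apply by (rule g) (simp add: dual_lmult_apply row)
  hence "cdual_apply (arens_box f g) \<omega> = R"
    unfolding arens_box_apply by (intro f) (simp add: r)
  moreover have "cdual_apply (bidual_lmult \<omega> f) (b j) = c j" for j
    unfolding bidual_lmult_apply by (rule f) (simp add: dual_rmult_apply col)
  hence "cdual_apply (arens_diamond f g) \<omega> = C"
    unfolding arens_diamond_apply by (intro g) (simp add: c)
  ultimately show ?thesis
    using \<open>R \<noteq> C\<close> unfolding arens_regular_def by metis
qed

section \<open>Functionals on the projective tensor product\<close>

definition elem_tensor ::
    "'a::complex_normed_algebra \<Rightarrow> 'b::complex_normed_algebra \<Rightarrow> ('a, 'b) proj_tensor"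
  where "elem_tensor x y = proj_embed (abs_alg_tensor [(x, y)])"

lemma elem_tensor_mult: "elem_tensor x y * elem_tensor x' y' = elem_tensor (x * x') (y * y')"
  by (simp add: elem_tensor_def proj_embed_simps [symmetric] times_alg_tensor.abs_eq)

lemma norm_elem_tensor_le: "norm (elem_tensor x y) \<le> norm x * norm y"
  using gamma_norm_le [of "[(x, y)]"]
  by (simp add: elem_tensor_def norm_proj_embed tensor_cost_simps)

text \<open>The setting for the universal property of the projective tensor product: the form
  extends first to lists, then to their classes, then to Cauchy sequences of classes.\<close>

locale bounded_cbilinear_form =
  fixes \<beta> :: "'a::complex_normed_algebra \<Rightarrow> 'b::complex_normed_algebra \<Rightarrow> complex" and K :: real
  assumes add_left: "\<beta> (x + x') y = \<beta> x y + \<beta> x' y"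
    and add_right: "\<beta> x (y + y') = \<beta> x y + \<beta> x y'"
    and scale_left: "\<beta> (c *\<^sub>C x) y = c * \<beta> x y"
    and scale_right: "\<beta> x (c *\<^sub>C y) = c * \<beta> x y"
    and bound: "cmod (\<beta> x y) \<le> K * (norm x * norm y)"
    and K_nonneg: "0 \<le> K"
begin

definition list_form :: "('a \<times> 'b) list \<Rightarrow> complex"
  where "list_form xs = (\<Sum>(x, y)\<leftarrow>xs. \<beta> x y)"

lemma list_form_cong: "xs \<approx>\<^sub>T ys \<Longrightarrow> list_form xs = list_form ys"
proof (induction rule: tensor_eq.induct)
  case (zero y)
  \<comment> \<open>Vanishing at a zero vector is scaling by the scalar 0.\<close>
  show ?case using scale_left [of 0 0 y] by (simp add: list_form_def)
qed (simp_all add: list_form_def add_left add_right scale_left scale_right)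

lift_definition alg_form :: "('a, 'b) alg_tensor \<Rightarrow> complex" is list_form
  by (rule list_form_cong)

lemma alg_form_add: "alg_form (u + v) = alg_form u + alg_form v"
  by transfer (simp add: list_form_def)

lemma alg_form_scaleC: "alg_form (c *\<^sub>C u) = c * alg_form u"
proof transfer
  show "list_form (map (\<lambda>(x, y). (c *\<^sub>C x, y)) xs) = c * list_form xs" for c xs
    by (induction xs) (auto simp: list_form_def scale_left distrib_left)
qed

lemma alg_form_diff: "alg_form (u - v) = alg_form u - alg_form v"
  using alg_form_add [of "u - v" v] by simp

text \<open>The triangle inequality bounds the form by the cost of any representing list; a nearly
  optimal list turns the cost into \<open>gamma_norm\<close>.\<close>

lemma cmod_alg_form_le: "cmod (alg_form u) \<le> K * gamma_norm u"
proof -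
  have le: "cmod (list_form xs) \<le> K * tensor_cost xs" for xs
  proof (induction xs)
    case (Cons p xs)
    obtain x y where p: "p = (x, y)" by fastforce
    have "cmod (list_form (p # xs)) \<le> cmod (\<beta> x y) + cmod (list_form xs)"
      by (simp add: p list_form_def norm_triangle_ineq)
    also have "\<dots> \<le> K * (norm x * norm y) + K * tensor_cost xs"
      by (intro add_mono bound Cons.IH)
    finally show ?case by (simp add: p tensor_cost_simps distrib_left)
  qed (simp add: list_form_def tensor_cost_simps)
  show ?thesis
  proof (rule field_le_epsilon)
    fix e :: real assume "e > 0"
    \<comment> \<open>\<open>K\<close> may be 0; dividing by \<open>K + 1\<close> is safe and still
      leaves \<open>K * (e / (K + 1)) \<le> e\<close>.\<close>
    hence e: "e / (K + 1) > 0" using K_nonneg by (simp add: add_nonneg_pos)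
    obtain xs where xs: "abs_alg_tensor xs = u" "tensor_cost xs < gamma_norm u + e / (K + 1)"
      by (rule gamma_norm_approx [OF e])
    have "cmod (alg_form u) \<le> K * tensor_cost xs"
      using le [of xs] by (simp add: xs(1) [symmetric] alg_form.abs_eq)
    also have "\<dots> \<le> K * (gamma_norm u + e / (K + 1))"
      using xs(2) K_nonneg by (intro mult_left_mono) simp_all
    also have "\<dots> \<le> K * gamma_norm u + e"
      using K_nonneg \<open>e > 0\<close> by (simp add: field_simps)
    finally show "cmod (alg_form u) \<le> K * gamma_norm u + e" .
  qed
qed

lemma alg_form_tendsto_lim:
  assumes "gamma_Cauchy X"
  shows "(\<lambda>n. alg_form (X n)) \<longlonglongrightarrow> lim (\<lambda>n. alg_form (X n))"
proof -
  have "Cauchy (\<lambda>n. alg_form (X n))"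
  proof (rule CauchyI)
    fix e :: real assume "e > 0"
    hence "e / (K + 1) > 0" using K_nonneg by (simp add: add_nonneg_pos)
    then obtain N where N: "\<And>m n. m \<ge> N \<Longrightarrow> n \<ge> N \<Longrightarrow> gamma_norm (X m - X n) < e / (K + 1)"
      using assms unfolding gamma_Cauchy_def by blast
    have "norm (alg_form (X m) - alg_form (X n)) < e" if "m \<ge> N" "n \<ge> N" for m n
    proof -
      have "norm (alg_form (X m) - alg_form (X n)) \<le> K * gamma_norm (X m - X n)"
        using cmod_alg_form_le [of "X m - X n"] by (simp add: alg_form_diff)
      also have "\<dots> \<le> (K + 1) * gamma_norm (X m - X n)"
        by (simp add: mult_right_mono gamma_norm_nonneg)
      also have "\<dots> < e"
        using N [OF that] K_nonneg by (simp add: pos_less_divide_eq add_nonneg_pos mult.commute)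
      finally show ?thesis .
    qed
    thus "\<exists>M. \<forall>m\<ge>M. \<forall>n\<ge>M. norm (alg_form (X m) - alg_form (X n)) < e" by blast
  qed
  thus ?thesis
    by (intro convergent_LIMSEQ_iff [THEN iffD1] Cauchy_convergent)
qed

text \<open>The limit is taken along a chosen representative; \<open>proj_form_tendsto\<close> shows
  that every Cauchy representative gives the same value.\<close>

definition proj_form :: "('a, 'b) proj_tensor \<Rightarrow> complex"
  where "proj_form P = lim (\<lambda>n. alg_form (rep_proj_tensor P n))"

text \<open>\<open>X\<close> and the chosen representative differ by a \<open>gamma_norm\<close>
  null sequence, which the Lipschitz bound on \<open>alg_form\<close> sends to a null
  sequence.\<close>

lemma proj_form_tendsto:
  assumes "gamma_Cauchy X"
  shows "(\<lambda>n. alg_form (X n)) \<longlonglongrightarrow> proj_form (abs_proj_tensor X)"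
proof -
  let ?Y = "rep_proj_tensor (abs_proj_tensor X)"
  have "completion_eq ?Y X"
    using assms by (intro Quotient_rep_abs [OF Quotient_proj_tensor]) (simp add: completion_eq_refl_iff)
  hence eq: "completion_eq X ?Y"
    by (simp add: completion_eq_def gamma_norm_minus_commute)
  have Y: "(\<lambda>n. alg_form (?Y n)) \<longlonglongrightarrow> proj_form (abs_proj_tensor X)"
    using eq unfolding completion_eq_def proj_form_def by (blast intro: alg_form_tendsto_lim)
  have "(\<lambda>n. K * gamma_norm (X n - ?Y n)) \<longlonglongrightarrow> K * 0"
    using eq unfolding completion_eq_def by (intro tendsto_mult tendsto_const) simp_all
  hence "(\<lambda>n. K * gamma_norm (X n - ?Y n)) \<longlonglongrightarrow> 0"
    by simp
  hence "(\<lambda>n. alg_form (X n) - alg_form (?Y n)) \<longlonglongrightarrow> 0"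
    by (rule Lim_null_comparison [rotated]) (simp add: alg_form_diff [symmetric] cmod_alg_form_le)
  from tendsto_add [OF this Y] show ?thesis by simp
qed

lemma bounded_clinear_proj_form: "bounded_clinear proj_form"
proof (rule bounded_clinear_functionalI [where K = K])
  fix P Q :: "('a, 'b) proj_tensor" and c :: complex
  obtain X where X: "gamma_Cauchy X" "P = abs_proj_tensor X" by (rule proj_tensor_rep)
  obtain Y where Y: "gamma_Cauchy Y" "Q = abs_proj_tensor Y" by (rule proj_tensor_rep)
  show "proj_form (P + Q) = proj_form P + proj_form Q"
  proof (rule LIMSEQ_unique)
    show "(\<lambda>n. alg_form (X n + Y n)) \<longlonglongrightarrow> proj_form (P + Q)"
      using proj_form_tendsto [OF gamma_Cauchy_add [OF X(1) Y(1)]]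
      by (simp add: X Y abs_proj_tensor_simps)
    show "(\<lambda>n. alg_form (X n + Y n)) \<longlonglongrightarrow> proj_form P + proj_form Q"
      unfolding alg_form_add X(2) Y(2) by (intro tendsto_add proj_form_tendsto X Y)
  qed
  show "proj_form (c *\<^sub>C P) = c * proj_form P"
  proof (rule LIMSEQ_unique)
    show "(\<lambda>n. alg_form (c *\<^sub>C X n)) \<longlonglongrightarrow> proj_form (c *\<^sub>C P)"
      using proj_form_tendsto [OF gamma_Cauchy_scaleC [OF X(1)]]
      by (simp add: X abs_proj_tensor_simps)
    show "(\<lambda>n. alg_form (c *\<^sub>C X n)) \<longlonglongrightarrow> c * proj_form P"
      unfolding alg_form_scaleC X(2) by (intro tendsto_mult tendsto_const proj_form_tendsto X)
  qed
  show "cmod (proj_form P) \<le> K * norm P"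
    unfolding X(2)
  proof (rule LIMSEQ_le)
    show "(\<lambda>n. cmod (alg_form (X n))) \<longlonglongrightarrow> cmod (proj_form (abs_proj_tensor X))"
      by (intro tendsto_norm proj_form_tendsto X)
    show "(\<lambda>n. K * gamma_norm (X n)) \<longlonglongrightarrow> K * norm (abs_proj_tensor X)"
      by (intro tendsto_mult tendsto_const abs_proj_tensor_norm X)
  qed (simp add: cmod_alg_form_le)
qed

text \<open>An elementary tensor is represented by a constant sequence, on which the limit defining
  \<open>proj_form\<close> is \<open>\<beta> x y\<close>.\<close>

lemma ex_cdual_elem_tensor:
  "\<exists>\<omega> :: ('a, 'b) proj_tensor cdual. \<forall>x y. cdual_apply \<omega> (elem_tensor x y) = \<beta> x y"
proof -
  have "proj_form (elem_tensor x y) = \<beta> x y" for x y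
    using LIMSEQ_unique [OF proj_form_tendsto [OF gamma_Cauchy_const] tendsto_const]
    by (simp add: elem_tensor_def proj_embed_def alg_form.abs_eq list_form_def)
  thus ?thesis
    by (intro exI [of _ "Abs_cdual proj_form"])
      (simp add: Abs_cdual_inverse bounded_clinear_proj_form)
qed

end

section \<open>Orthonormal families and rank one operators\<close>

text \<open>An indexed counterpart of \<open>orthonormal\<close>: families in two different spaces
  can then be summed over one common index set.\<close>

definition orthonormal_family :: "('i \<Rightarrow> 'a::complex_inner) \<Rightarrow> bool"
  where "orthonormal_family u \<longleftrightarrow> (\<forall>i j. cinner (u i) (u j) = (if i = j then 1 else 0))"

lemma orthonormal_familyD:
  "orthonormal_family u \<Longrightarrow> cinner (u i) (u j) = (if i = j then 1 else 0)"
  by (simp only: orthonormal_family_def)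

lemma orthonormal_family_norm:
  assumes "orthonormal_family u"
  shows "norm (u i) = 1"
proof -
  have "complex_of_real ((norm (u i))\<^sup>2) = 1"
    unfolding cinner_self [symmetric] by (simp add: orthonormal_familyD [OF assms])
  hence "(norm (u i))\<^sup>2 = 1"
    by (simp only: of_real_eq_1_iff)
  thus ?thesis
    using norm_ge_zero [of "u i"] by (simp add: power2_eq_1_iff)
qed

lemma orthonormal_family_inj: "orthonormal_family u \<Longrightarrow> inj u"
  by (rule injI) (metis orthonormal_family_def zero_neq_one)

lemma orthonormal_family_range: "orthonormal_family u \<Longrightarrow> orthonormal (range u)"
  by (auto simp: orthonormal_def orthonormal_family_norm) (auto simp: orthonormal_family_def)

text \<open>Bessel's inequality, phrased with \<open>L2_set\<close> to fit the Cauchy-Schwarz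
  inequality \<open>L2_set_mult_ineq\<close>.\<close>

lemma orthonormal_family_bessel:
  assumes u: "orthonormal_family u" and F: "finite F"
  shows "L2_set (\<lambda>i. cmod (cinner x (u i))) F \<le> norm x"
proof -
  have "(\<Sum>i\<in>F. (cmod (cinner x (u i)))\<^sup>2) = (\<Sum>e\<in>u ` F. (cmod (cinner x e))\<^sup>2)"
    by (subst sum.reindex) (auto intro: inj_on_subset [OF orthonormal_family_inj [OF u]])
  also have "\<dots> \<le> (norm x)\<^sup>2"
    using bessel [OF orthonormal_family_range [OF u], of "u ` F" x] F by (simp add: image_mono)
  finally show ?thesis
    unfolding L2_set_def by (simp add: real_le_lsqrt)
qed

text \<open>A finite orthonormal basis would span, since the basis expansion is then a finite sum.
  So a basis is infinite and contains an injective sequence.\<close>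

lemma infinite_dimensional_orthonormal_family:
  assumes "infinite_dimensional TYPE('a::complex_hilbert_space)"
  shows "\<exists>u :: nat \<Rightarrow> 'a. orthonormal_family u"
proof -
  obtain E :: "'a set" where E: "is_onb E" using ex_onb by blast
  have "infinite E"
  proof
    assume fin: "finite E"
    have "x \<in> complex_vector.span E" for x
    proof -
      have "x = (\<Sum>e\<in>E. cinner x e *\<^sub>C e)"
        using onb_expansion [OF E, of x] fin by (simp add: has_sum_finite_iff)
      also have "\<dots> \<in> complex_vector.span E"
        by (intro complex_vector.span_sum complex_vector.span_scale complex_vector.span_base)
      finally show ?thesis .
    qed
    thus False
      using assms fin unfolding infinite_dimensional_def by blast
  qed
  then obtain u :: "nat \<Rightarrow> 'a" where u: "inj u" "range u \<subseteq> E"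
    using infinite_countable_subset by blast
  have "cinner (u i) (u j) = (if i = j then 1 else 0)" for i j
  proof -
    have "u i \<in> E" "u j \<in> E" "orthonormal E"
      using u(2) E by (auto simp: is_onb_def)
    thus ?thesis
      by (simp add: orthonormal_cinner inj_eq [OF u(1)])
  qed
  thus ?thesis
    unfolding orthonormal_family_def by blast
qed

lemma hilbert_schmidt_rank_one: "hilbert_schmidt (\<lambda>x. cinner x (v::'a::complex_hilbert_space) *\<^sub>C u)"
proof -
  obtain E :: "'a set" where E: "is_onb E" using ex_onb by blast
  have lin: "bounded_clinear (\<lambda>x. cinner x v *\<^sub>C u)"
    unfolding bounded_clinear_def
    by (intro conjI allI bounded_linear_intro [of _ "norm v * norm u"])
      (simp_all add: cinner_add_left scaleC_add_left scaleR_scaleC cinner_scaleC_left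
        scaleC_scaleC norm_scaleC mult_right_mono [OF cmod_cinner_le] mult.assoc [symmetric])
  have "(\<lambda>e. (cmod (cinner v e))\<^sup>2 * (norm u)\<^sup>2) summable_on E"
    using E by (intro summable_on_cmult_left bessel_summable) (simp add: is_onb_def)
  moreover have "(cmod (cinner v e))\<^sup>2 * (norm u)\<^sup>2 = (norm (cinner e v *\<^sub>C u))\<^sup>2" for e
    using cinner_commute [of v e] by (simp add: norm_scaleC power_mult_distrib)
  ultimately show ?thesis
    using lin E unfolding hilbert_schmidt_def by auto
qed

text \<open>For an orthonormal family \<open>u\<close>, \<open>rank_one (u i) (u j)\<close> is the
  matrix unit with index \<open>(i, j)\<close>.\<close>

lift_definition rank_one :: "'a::complex_hilbert_space \<Rightarrow> 'a \<Rightarrow> 'a hs_op" is "\<lambda>u v x. cinner x v *\<^sub>C u"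
  by (rule hilbert_schmidt_rank_one)

lemma rank_one_mult: "rank_one u v * rank_one u' v' = cinner u' v *\<^sub>C rank_one u v'"
  by (rule hs_apply_inject [THEN iffD1, OF ext])
    (simp add: times_hs_op.rep_eq rank_one.rep_eq hs_apply_simps cinner_scaleC_left scaleC_scaleC mult.commute)

text \<open>Pairing with a matrix unit reads off a matrix entry: expand \<open>v\<close> in a basis,
  pull the sum through \<open>A\<close>, and recognise the Hilbert-Schmidt inner product.\<close>

lemma cinner_rank_one: "cinner A (rank_one u v) = cinner (hs_apply A v) u"
proof -
  obtain E :: "'a set" where E: "is_onb E" using ex_onb by blast
  note lin = bounded_clinearD [OF hs_apply_bounded_clinear]
  have "((\<lambda>e. cinner (hs_apply A (cinner v e *\<^sub>C e)) u) has_sum cinner (hs_apply A v) u) E"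
    by (rule has_sum_bounded_linear [OF bounded_linear_cinner_left
        has_sum_bounded_linear [OF lin(1) onb_expansion [OF E]]])
  moreover have "cinner (hs_apply A (cinner v e *\<^sub>C e)) u
      = cinner (hs_apply A e) (hs_apply (rank_one u v) e)" for e
    by (simp add: lin rank_one.rep_eq cinner_scaleC_left cinner_scaleC_right cinner_commute [of v e])
  ultimately show ?thesis
    using has_sum_unique [OF has_sum_cinner_hs [OF E, of A "rank_one u v"]]
    by (simp add: cinner_hs_op_def)
qed

lemma orthonormal_family_rank_one:
  assumes "orthonormal_family u"
  shows "orthonormal_family (\<lambda>(i, j). rank_one (u i) (u j))"
  using assms by (auto simp: orthonormal_family_def cinner_rank_one rank_one.rep_eq cinner_scaleC_left)

text \<open>Cauchy-Schwarz and Bessel in each factor bound every finite sum of absolute values by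
  \<open>norm S * norm T\<close>. This bound is uniform in the index set, so restricting the sum to
  any \<open>I\<close>, in particular to a triangle, keeps the form bounded.\<close>

lemma bounded_cbilinear_form_orthonormal:
  fixes \<theta> :: "'i \<Rightarrow> 'a::complex_hilbert_space hs_op" and \<eta> :: "'i \<Rightarrow> 'b::complex_hilbert_space hs_op"
  assumes \<theta>: "orthonormal_family \<theta>" and \<eta>: "orthonormal_family \<eta>"
  shows "bounded_cbilinear_form (\<lambda>S T. \<Sum>\<^sub>\<infinity>p\<in>I. cinner S (\<theta> p) * cinner T (\<eta> p)) 1"
proof -
  let ?h = "\<lambda>S T p. cinner S (\<theta> p) * cinner T (\<eta> p)"
  have fin: "(\<Sum>p\<in>F. norm (?h S T p)) \<le> norm S * norm T" if "finite F" for F S T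
  proof -
    have "(\<Sum>p\<in>F. norm (?h S T p)) = (\<Sum>p\<in>F. \<bar>cmod (cinner S (\<theta> p))\<bar> * \<bar>cmod (cinner T (\<eta> p))\<bar>)"
      by (simp add: norm_mult)
    also have "\<dots> \<le> L2_set (\<lambda>p. cmod (cinner S (\<theta> p))) F * L2_set (\<lambda>p. cmod (cinner T (\<eta> p))) F"
      by (rule L2_set_mult_ineq)
    also have "\<dots> \<le> norm S * norm T"
      by (intro mult_mono orthonormal_family_bessel \<theta> \<eta> that L2_set_nonneg norm_ge_zero)
    finally show ?thesis .
  qed
  have abs: "(\<lambda>p. norm (?h S T p)) summable_on I" for S T
    unfolding abs_summable_iff_bdd_above
    by (rule bdd_aboveI2 [of _ _ "norm S * norm T"]) (simp add: fin)
  \<comment> \<open>A divergent \<open>infsum\<close> is 0 by convention, so additivity of the form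
    rests on this convergence.\<close>
  note sm = abs_summable_summable [OF abs]
  show ?thesis
  proof
    fix S S' :: "'a hs_op" and T T' :: "'b hs_op" and c :: complex
    show "infsum (?h (S + S') T) I = infsum (?h S T) I + infsum (?h S' T) I"
      unfolding infsum_add [OF sm sm, symmetric] by (simp add: cinner_add_left distrib_right)
    show "infsum (?h S (T + T')) I = infsum (?h S T) I + infsum (?h S T') I"
      unfolding infsum_add [OF sm sm, symmetric] by (simp add: cinner_add_left distrib_left)
    show "infsum (?h (c *\<^sub>C S) T) I = c * infsum (?h S T) I"
      unfolding infsum_cmult_right' [symmetric] by (simp add: cinner_scaleC_left mult.assoc)
    show "infsum (?h S (c *\<^sub>C T)) I = c * infsum (?h S T) I"
      unfolding infsum_cmult_right' [symmetric] by (simp add: cinner_scaleC_left mult.left_commute)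
    have "cmod (infsum (?h S T) I) \<le> (\<Sum>\<^sub>\<infinity>p\<in>I. norm (?h S T p))"
      by (rule norm_infsum_bound [OF abs])
    also have "\<dots> \<le> norm S * norm T"
      by (rule infsum_le_finite_sums [OF abs fin])
    finally show "cmod (infsum (?h S T) I) \<le> 1 * (norm S * norm T)"
      by simp
  qed simp
qed

section \<open>The triangular form on pairs of matrix units\<close>

theorem theorem4p1:
  assumes "infinite_dimensional TYPE('h1::complex_hilbert_space)"
    and "infinite_dimensional TYPE('h2::complex_hilbert_space)"
  shows "\<not> arens_regular TYPE(('h1 hs_op, 'h2 hs_op) proj_tensor)"
proof -
  obtain u :: "nat \<Rightarrow> 'h1" where u: "orthonormal_family u"
    using infinite_dimensional_orthonormal_family [OF assms(1)] by blast
  obtain v :: "nat \<Rightarrow> 'h2" where v: "orthonormal_family v"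
    using infinite_dimensional_orthonormal_family [OF assms(2)] by blast
  define \<theta> where "\<theta> = (\<lambda>(i, j). rank_one (u i) (u j))"
  define \<eta> where "\<eta> = (\<lambda>(i, j). rank_one (v i) (v j))"
  have \<theta>: "orthonormal_family \<theta>" and \<eta>: "orthonormal_family \<eta>"
    unfolding \<theta>_def \<eta>_def by (intro orthonormal_family_rank_one u v)+
  define I :: "(nat \<times> nat) set" where "I = {(i, j). i \<le> j}"
  obtain \<omega> :: "('h1 hs_op, 'h2 hs_op) proj_tensor cdual"
    where \<omega>: "\<And>S T. cdual_apply \<omega> (elem_tensor S T) = (\<Sum>\<^sub>\<infinity>p\<in>I. cinner S (\<theta> p) * cinner T (\<eta> p))"
    using bounded_cbilinear_form.ex_cdual_elem_tensor
      [OF bounded_cbilinear_form_orthonormal [OF \<theta> \<eta>, of I]] by blast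
  define a where "a i = elem_tensor (\<theta> (i, 0)) (\<eta> (i, 0))" for i
  define b where "b j = elem_tensor (\<theta> (0, j)) (\<eta> (0, j))" for j
  \<comment> \<open>The inner index 0 contracts to \<open>cinner (u 0) (u 0) = 1\<close>, and
    likewise for \<open>v\<close>.\<close>
  have "a i * b j = elem_tensor (\<theta> (i, j)) (\<eta> (i, j))" for i j
    using u v by (simp add: a_def b_def elem_tensor_mult \<theta>_def \<eta>_def rank_one_mult orthonormal_family_def)
  moreover have "(\<Sum>\<^sub>\<infinity>p\<in>I. cinner (\<theta> q) (\<theta> p) * cinner (\<eta> q) (\<eta> p)) = (if q \<in> I then 1 else 0)" for q
  \<comment> \<open>By orthonormality only \<open>p = q\<close> contributes, and only if
    \<open>q\<close> lies in \<open>I\<close>.\<close>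
  proof (rule infsumI, rule has_sum_finite_neutralI [of "I \<inter> {q}"])
    show "(if q \<in> I then 1 else 0) = (\<Sum>p\<in>I \<inter> {q}. cinner (\<theta> q) (\<theta> p) * cinner (\<eta> q) (\<eta> p))"
      by (simp add: orthonormal_familyD [OF \<theta>] orthonormal_familyD [OF \<eta>])
  qed (auto simp: orthonormal_familyD [OF \<theta>])
  ultimately have ab: "cdual_apply \<omega> (a i * b j) = (if i \<le> j then 1 else 0)" for i j
    by (simp add: \<omega> I_def)
  show ?thesis
  proof (rule not_arens_regularI)
    show "norm (a i) \<le> 1" "norm (b i) \<le> 1" for i
      using norm_elem_tensor_le [of "\<theta> (i, 0)" "\<eta> (i, 0)"] norm_elem_tensor_le [of "\<theta> (0, i)" "\<eta> (0, i)"]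
      by (simp_all add: a_def b_def orthonormal_family_norm \<theta> \<eta>)
    show "(\<lambda>j. cdual_apply \<omega> (a i * b j)) \<longlonglongrightarrow> 1" for i
      unfolding ab by (rule tendsto_eventually) (rule eventually_mono [OF eventually_ge_at_top [of i]], simp)
    show "(\<lambda>i. cdual_apply \<omega> (a i * b j)) \<longlonglongrightarrow> 0" for j
      unfolding ab by (rule tendsto_eventually) (rule eventually_mono [OF eventually_gt_at_top [of j]], simp)
  \<comment> \<open>The row limits are constantly 1 and the column limits constantly 0, so the
    iterated limits are 1 and 0.\<close>
  qed (rule tendsto_const zero_neq_one [symmetric])+
qed

end
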